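(* Let $r\ge 1$, let $N\ge 3$ be an integer, let $\lambda>0$, and let $-\infty<a<b<+\infty$. For $b'>0$ let $x^{N,1,0,b'}=(x_1,\ldots,x_N)$, $0=x_1<\cdots<x_N=b'$, denote the points of the unique $L^r$-optimal dual quantization grid at level $N$ of the truncated exponential distribution with parameter $1$ on $[0,b']$, and set $\Delta x_i=x_i-x_{i-1}$ for $i=2,\ldots,N$. (i) The points of the unique $L^r$-optimal dual quantization grid at level $N$ of the truncated exponential distribution with parameter $\lambda$ on $[a,b]$ are $a+\frac1\lambda x_i^{N,1,0,\lambda(b-a)}$, $i=1,\ldots,N$. (ii) If $r=2$, then $\Phi_2$ and $\check\Phi_2$ restricted to $\mathbb{R}_+$ are increasing bijections of $\mathbb{R}_+$, and with $\theta_2=\Phi_2^{-1}\circ\check\Phi_2$ the equation $\sum_{k=0}^{N-2}\theta_2^{\circ k}(x)=b'$ has a unique solution $x\in\mathbb{R}_+$; moreover $\Delta x_i=\theta_2^{\circ(i-2)}(x)$ for $i=2,\ldots,N$. (iii) If $r>1$, then $\check\Phi_r$ restricted to $\mathbb{R}_+$ is an increasing bijection of $\mathbb{R}_+$, and with $\widetilde\theta_r=\check\Phi_r^{-1}\circ\Phi_r$ on $\mathbb{R}_+$ the equation $\sum_{k=0}^{N-2}\widetilde\theta_r^{\circ k}(x)=b'$ has a unique solution $x\in\mathbb{R}_+$; moreover $\Delta x_i=\widetilde\theta_r^{\circ(N-i)}(x)$ for $i=2,\ldots,N$. (iv) If $r=1$, then $\Phi_1$ restricted to $(0,+\infty)$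 is an increasing bijection onto $(0,2)$, $\check\Phi_1$ restricted to $(0,+\infty)$ is an increasing bijection of $(0,+\infty)$, and with $\theta_1=\Phi_1^{-1}\circ\check\Phi_1$ on $[0,\check\Phi_1^{-1}(2))$ (where $\theta_1(0)=0$), the equation $\sum_{k=0}^{N-2}\theta_1^{\circ k}(x)=b'$ has a solution $x$ among those $x\ge0$ for which all the compositions are defined; moreover $\Delta x_i=\theta_1^{\circ(i-2)}(x)$ for $i=2,\ldots,N$.
   Context: The truncated exponential distribution with parameter $\lambda>0$ on $[a,b]$ is the probability measure with density proportional to $\mathbf{1}_{[a,b]}(x)e^{-\lambda(x-a)}$. For $z\in(0,1)$, $\Psi_r(z)=(r-1)z(1-z)^r+z^{r+1}+rz^2(1-z)^{r-1}$. For $x\in\mathbb{R}$, $\Phi_r(x)=|x|^re^{-x}\int_0^1\Psi_r(z)e^{xz}\,dz$, and $\check\Phi_r(x)=\Phi_r(-x)$ for $x\ge 0$; at $0$ these functions vanish. $\theta^{\circ k}$ denotes the $k$-fold composition of $\theta$ with itself, $\theta^{\circ 0}$ being the identity. A dual quantization grid at level $N$ for a probability measure $\mu$ with $\mathrm{conv}(\mathrm{supp}(\mu))=[a,b]$ is a finite set $\Gamma=\{x_1<\cdots<x_M\}\subset\mathbb{R}$, $M\le N$, with $x_1\le a$ and $x_M\ge b$. It is $L^r$-optimal at level $N$ if, among all such grids, it minimizes $$\sum_{i=1}^{M-1}\int_{[x_i,x_{i+1})}\Big((\xi-x_i)^r\frac{x_{i+1}-\xi}{x_{i+1}-x_i}+(x_{i+1}-\xi)^r\frac{\xi-x_i}{x_{i+1}-x_i}\Big)\mu(d\xi).$$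 For truncated exponential distributions and $N\ge3$ the $L^r$-optimal grid is unique and has exactly $N$ points, including the two endpoints of the support. *)

theory Defs
  imports "HOL-Probability.Probability"
begin

definition trunc_exp :: "real \<Rightarrow> real \<Rightarrow> real \<Rightarrow> real measure" where
  "trunc_exp l a b =
     density lborel (\<lambda>x. ennreal (indicator {a..b} x * exp (- l * (x - a)) /
                                 (LINT y|lborel. indicator {a..b} y * exp (- l * (y - a)))))"

definition msupport :: "real measure \<Rightarrow> real set" where
  "msupport \<mu> = {x. \<forall>U. open U \<and> x \<in> U \<longrightarrow> emeasure \<mu> U > 0}"

definition dq_grid :: "nat \<Rightarrow> real measure \<Rightarrow> real set \<Rightarrow> bool" where
  "dq_grid N \<mu> \<Gamma> \<longleftrightarrow> finite \<Gamma> \<and> \<Gamma> \<noteq> {} \<and> card \<Gamma> \<le> N \<and>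
     (\<exists>a b. a \<le> b \<and> convex hull (msupport \<mu>) = {a..b} \<and> Min \<Gamma> \<le> a \<and> b \<le> Max \<Gamma>)"

text \<open>The points of a grid, in increasing order and counted from \<open>0\<close>, are
  \<open>sorted_list_of_set \<Gamma> ! i\<close>. Since \<open>0 powr r = 0\<close>, the real powers of the nonnegative
  bases below are the usual ones for \<open>r \<ge> 1\<close>.\<close>

definition dq_error :: "real \<Rightarrow> real measure \<Rightarrow> real set \<Rightarrow> real" where
  "dq_error r \<mu> \<Gamma> =
     (let xs = sorted_list_of_set \<Gamma> in
      \<Sum>i<card \<Gamma> - 1.
        LINT \<xi>:{xs ! i..<xs ! Suc i}|\<mu>.
          (\<xi> - xs ! i) powr r * ((xs ! Suc i - \<xi>) / (xs ! Suc i - xs ! i))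
        + (xs ! Suc i - \<xi>) powr r * ((\<xi> - xs ! i) / (xs ! Suc i - xs ! i)))"

definition dq_optimal :: "real \<Rightarrow> nat \<Rightarrow> real measure \<Rightarrow> real set \<Rightarrow> bool" where
  "dq_optimal r N \<mu> \<Gamma> \<longleftrightarrow>
     dq_grid N \<mu> \<Gamma> \<and> (\<forall>\<Gamma>'. dq_grid N \<mu> \<Gamma>' \<longrightarrow> dq_error r \<mu> \<Gamma> \<le> dq_error r \<mu> \<Gamma>')"

text \<open>Meaningful only if the optimal grid is unique.\<close>

definition dq_points :: "real \<Rightarrow> nat \<Rightarrow> real measure \<Rightarrow> real list" where
  "dq_points r N \<mu> = sorted_list_of_set (THE \<Gamma>. dq_optimal r N \<mu> \<Gamma>)"

definition std_point :: "real \<Rightarrow> nat \<Rightarrow> real \<Rightarrow> nat \<Rightarrow> real" where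
  "std_point r N b' i = dq_points r N (trunc_exp 1 0 b') ! (i - 1)"

definition std_gap :: "real \<Rightarrow> nat \<Rightarrow> real \<Rightarrow> nat \<Rightarrow> real" where
  "std_gap r N b' i = std_point r N b' i - std_point r N b' (i - 1)"

definition Psi :: "real \<Rightarrow> real \<Rightarrow> real" where
  "Psi r z = (r - 1) * z * (1 - z) powr r + z powr (r + 1) + r * z\<^sup>2 * (1 - z) powr (r - 1)"

definition Phi :: "real \<Rightarrow> real \<Rightarrow> real" where
  "Phi r x = \<bar>x\<bar> powr r * exp (- x) * (LINT z:{0<..<1}|lborel. Psi r z * exp (x * z))"

definition Phi_check :: "real \<Rightarrow> real \<Rightarrow> real" where
  "Phi_check r x = Phi r (- x)"

definition increasing_bij :: "(real \<Rightarrow> real) \<Rightarrow> real set \<Rightarrow> real set \<Rightarrow> bool" where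
  "increasing_bij f A B \<longleftrightarrow> strict_mono_on A f \<and> bij_betw f A B"

definition theta2 :: "real \<Rightarrow> real" where
  "theta2 x = inv_into {0..} (Phi 2) (Phi_check 2 x)"

definition theta_tilde :: "real \<Rightarrow> real \<Rightarrow> real" where
  "theta_tilde r x = inv_into {0..} (Phi_check r) (Phi r x)"

definition theta1_dom :: "real set" where
  "theta1_dom = {0..<inv_into {0<..} (Phi_check 1) 2}"

text \<open>Only the values on \<^const>\<open>theta1_dom\<close> are meaningful.\<close>

definition theta1 :: "real \<Rightarrow> real" where
  "theta1 x = (if x = 0 then 0 else inv_into {0<..} (Phi 1) (Phi_check 1 x))"

end

theory Submission
  imports Defs "HOL-Real_Asymp.Real_Asymp"
begin

text \<open>Write \<open>c(u, v)\<close> for the unnormalised error of the cell \<open>[u, v]\<close> under the density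
  \<open>exp (- \<xi>)\<close>. By memorylessness \<open>c(u, v) = exp (- u) G(v - u)\<close>, and its partial derivatives are
  \<open>exp (- v) Phi_check(v - u)\<close> and \<open>- exp (- u) Phi(v - u)\<close>. Both \<^const>\<open>Phi\<close> and
  \<^const>\<open>Phi_check\<close> are strictly increasing on the half line for every \<open>r \<ge> 1\<close>, so the optimal
  position \<open>m\<close> of a single point between \<open>u\<close> and \<open>v\<close> is the unique one with
  \<open>Phi_check(m - u) = Phi(v - m)\<close>. A minimizer, which exists by compactness, therefore satisfies this
  relation at all interior points: every gap is the image under \<^const>\<open>theta_tilde\<close> of the next one. As
  \<^const>\<open>theta_tilde\<close> is increasing, the length of the interval determines the last gap, so the
  stationary sequence is unique. Points outside the support are excluded by the monotonicity of the
  pointwise error in the endpoints of a cell.\<close>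

text \<open>The recursion runs from the last gap backwards because \<open>Phi_check\<close> maps the
  half line onto itself for every admissible \<open>r\<close>, whereas \<open>Phi 1\<close> stays
  below 2. So \<open>theta_tilde\<close> is total and increasing, one uniqueness argument serves all
  exponents, and \<open>theta2\<close> and \<open>theta1\<close> reread the same gaps forwards.
  Monotonicity rests on one computation: memorylessness gives
  \<open>Phi r x = G x + exp (- x) * Phi_check r x\<close> for \<open>x > 0\<close>, and with
  \<open>G' = exp (- x) * Phi_check\<close> this yields \<open>Phi_check' = exp x * Phi'\<close>;
  after partial integration the positivity of \<open>Phi'\<close> reduces to s < x under an
  integral. Two degeneracies shape the rest. Grids may have fewer points or overshoot the support,
  so each grid is clipped and padded to a sequence, which never raises the error. Minimizing
  sequences might repeat points, so stationarity is derived without assuming a point to lie strictly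
  between its neighbours; positive gaps follow afterwards because \<open>theta_tilde\<close> fixes
  0.\<close>

lemma powr_Suc_mult: "x \<ge> 0 \<Longrightarrow> x * x powr p = x powr (p + 1)" for x p :: real
  by (cases "x = 0") (simp_all add: powr_add)

subsection \<open>Incomplete gamma integrals\<close>

lemma continuous_on_powr_exp:
  fixes p c :: real
  assumes "p > 0"
  shows "continuous_on {0..x} (\<lambda>s. s powr p * exp (c * s))"
  using assms by (intro continuous_on_mult continuous_on_powr' continuous_intros) auto

text \<open>For \<open>c = - 1\<close> this is the lower incomplete gamma function at
  \<open>p + 1\<close>; \<open>c = 1\<close> arises from the mirrored half of a cell after replacing
  s by x - s.\<close>

definition pexp :: "real \<Rightarrow> real \<Rightarrow> real \<Rightarrow> real" where
  "pexp c p x = integral {0..x} (\<lambda>s. s powr p * exp (c * s))"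

lemma pexp_integrand_integrable:
  fixes p c x :: real
  assumes "p \<ge> 0"
  shows "(\<lambda>s. s powr p * exp (c * s)) integrable_on {0..x}"
\<comment> \<open>Since \<open>0 powr 0 = 0\<close>, the integrand for \<open>p = 0\<close> jumps at
  the left end. This case arises from the exponent \<open>r - 1\<close> at
  \<open>r = 1\<close>.\<close>
proof (cases "p = 0")
  case True
  have "(\<lambda>s. exp (c * s)) integrable_on cbox 0 x"
    by (intro integrable_continuous continuous_intros)
  then show ?thesis
    using integrable_spike_interior[of 0 x "\<lambda>s. s powr p * exp (c * s)" "\<lambda>s. exp (c * s)"] True
    by simp
next
  case False
  then show ?thesis
    using assms by (intro integrable_continuous_real continuous_on_powr_exp) auto
qed

lemma pexp_has_integral:
  "p \<ge> 0 \<Longrightarrow> ((\<lambda>s. s powr p * exp (c * s)) has_integral pexp c p x) {0..x}"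
  unfolding pexp_def using pexp_integrand_integrable integrable_integral by blast

lemma pexp_zero [simp]: "pexp c p 0 = 0"
  by (simp add: pexp_def)

lemma pexp_nonneg: "pexp c p x \<ge> 0"
  unfolding pexp_def by (cases "(\<lambda>s. s powr p * exp (c * s)) integrable_on {0..x}")
    (auto intro: integral_nonneg simp: not_integrable_integral)

text \<open>Partial integration, that is, the recursion of the incomplete gamma function. It removes
  the exponents \<open>r - 1\<close> and produces the explicit values for small integer
  exponents.\<close>

lemma pexp_add_one:
  assumes "p \<ge> 0" "x \<ge> 0"
  shows "c * pexp c (p + 1) x = x powr (p + 1) * exp (c * x) - (p + 1) * pexp c p x"
proof -
  have "((\<lambda>s. (p + 1) * (s powr p * exp (c * s)) + c * (s powr (p + 1) * exp (c * s)))
      has_integral x powr (p + 1) * exp (c * x) - 0 powr (p + 1) * exp (c * 0)) {0..x}"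
  \<comment> \<open>The interior form is used because the power rule for \<open>powr\<close> breaks
    down at \<open>s = 0\<close>.\<close>
  proof (rule fundamental_theorem_of_calculus_interior)
    show "continuous_on {0..x} (\<lambda>s. s powr (p + 1) * exp (c * s))"
      using assms by (intro continuous_on_powr_exp) auto
    fix s assume "s \<in> {0<..<x}"
    then have "((\<lambda>s. s powr (p + 1) * exp (c * s)) has_real_derivative
        (p + 1) * (s powr p * exp (c * s)) + c * (s powr (p + 1) * exp (c * s))) (at s)"
      by (auto intro!: derivative_eq_intros simp: algebra_simps)
    then show "((\<lambda>s. s powr (p + 1) * exp (c * s)) has_vector_derivative
        (p + 1) * (s powr p * exp (c * s)) + c * (s powr (p + 1) * exp (c * s))) (at s)"
      by (simp add: has_real_derivative_iff_has_vector_derivative)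
  qed (use assms in auto)
  moreover have "((\<lambda>s. (p + 1) * (s powr p * exp (c * s)) + c * (s powr (p + 1) * exp (c * s)))
      has_integral (p + 1) * pexp c p x + c * pexp c (p + 1) x) {0..x}"
    using assms by (intro has_integral_add has_integral_mult_right pexp_has_integral) auto
  ultimately have "x powr (p + 1) * exp (c * x) - 0 powr (p + 1) * exp (c * 0) =
      (p + 1) * pexp c p x + c * pexp c (p + 1) x"
    by (rule has_integral_unique)
  then show ?thesis by simp
qed

lemma pexp_deriv [derivative_intros]:
  assumes "p > 0" "x > 0"
  shows "(pexp c p has_real_derivative x powr p * exp (c * x)) (at x)"
proof -
  have "((\<lambda>y. integral {0..y} (\<lambda>s. s powr p * exp (c * s))) has_real_derivative
      x powr p * exp (c * x)) (at x within {0..x + 1})"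
    using assms by (intro integral_has_real_derivative continuous_on_powr_exp) auto
  then show ?thesis
    using assms at_within_Icc_at[of 0 x "x + 1"] by (simp add: pexp_def[abs_def])
qed

lemma pexp_reflect_has_integral:
  assumes "p \<ge> 0"
  shows "((\<lambda>s. (x - s) powr p * exp (- s)) has_integral exp (- x) * pexp 1 p x) {0..x}"
proof (cases "x \<ge> 0")
  case True
  have "((\<lambda>s. s powr p * exp s) has_integral pexp 1 p x) (cbox 0 x)"
    using pexp_has_integral[OF assms, of 1 x] by simp
  from has_integral_affinity[OF this, of "-1" x]
  have "((\<lambda>s. (x - s) powr p * exp (x - s)) has_integral pexp 1 p x) {0..x}"
    using True image_affinity_cbox[of "-1" x 0 x] by (simp add: algebra_simps)
  from has_integral_mult_right[OF this, of "exp (- x)"]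
  show ?thesis by (simp add: exp_diff exp_minus field_simps)
qed (simp add: pexp_def)

text \<open>One factor s of the integrand is replaced by its upper bound x. This is the inequality
  behind \<open>Phi_deriv_pos\<close>.\<close>

lemma pexp_less:
  assumes "p > 0" "x > 0"
  shows "pexp c (p + 1) x < x * pexp c p x"
proof -
  have "pexp c (p + 1) x < integral {0..x} (\<lambda>s. x * (s powr p * exp (c * s)))"
    unfolding pexp_def
  proof (rule integral_less_real)
    fix s assume "s \<in> {0<..<x}"
    then show "s powr (p + 1) * exp (c * s) < x * (s powr p * exp (c * s))"
      using powr_Suc_mult[of s p] mult_strict_right_mono[of s x "s powr p"] by simp
  qed (use assms in \<open>auto intro!: continuous_on_powr_exp continuous_on_mult_left\<close>)
  then show ?thesis by (simp add: pexp_def)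
qed

text \<open>The smaller side of \<open>pexp_less\<close> is already nonnegative.\<close>

lemma pexp_pos: "p > 0 \<Longrightarrow> x > 0 \<Longrightarrow> pexp c p x > 0"
  using pexp_less[of p x c] pexp_nonneg[of c "p + 1" x]
  by (meson order_le_less_trans zero_less_mult_pos)

text \<open>Length times a crude bound of the integrand, valid for both signs of \<open>c\<close>;
  what matters is the order \<open>p + 1\<close> of vanishing at 0.\<close>

lemma pexp_le:
  assumes "p \<ge> 0" "x \<ge> 0"
  shows "pexp c p x \<le> x * (x powr p * exp \<bar>c * x\<bar>)"
proof -
  have "pexp c p x \<le> integral {0..x} (\<lambda>s. x powr p * exp \<bar>c * x\<bar>)"
    unfolding pexp_def
  proof (rule integral_le[OF pexp_integrand_integrable])
    fix s assume s: "s \<in> {0..x}"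
    then have "c * s \<le> \<bar>c * x\<bar>"
      using abs_ge_self[of "c * s"] mult_left_mono[of "\<bar>s\<bar>" "\<bar>x\<bar>" "\<bar>c\<bar>"] by (simp add: abs_mult)
    then show "s powr p * exp (c * s) \<le> x powr p * exp \<bar>c * x\<bar>"
      using s assms by (intro mult_mono powr_mono2) auto
  qed (use assms in auto)
  then show ?thesis using assms by (simp add: mult_ac)
qed

lemma powr_Suc_diff: "s \<le> x \<Longrightarrow> (x - s) powr (p + 1) = x * (x - s) powr p - s * (x - s) powr p"
  for x s p :: real
  using powr_Suc_mult[of "x - s" p] by (simp add: left_diff_distrib)

subsection \<open>Closed forms of the cell error and of its partial derivatives\<close>

text \<open>The function \<open>G\<close> of the overview, in closed form.\<close>

definition std_cell :: "real \<Rightarrow> real \<Rightarrow> real" where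
  "std_cell r x = pexp (- 1) r x - pexp (- 1) (r + 1) x / x
     + exp (- x) * (pexp 1 r x - pexp 1 (r + 1) x / x)"

text \<open>Writing each weight as 1 minus the opposite weight splits the integrand into pure powers
  of s and of x - s. For \<open>x \<le> 0\<close> the interval is negligible and
  \<open>std_cell\<close> vanishes as well.\<close>

lemma std_cell_has_integral:
  assumes "r \<ge> 0"
  shows "((\<lambda>s. (s powr r * (x - s) + (x - s) powr r * s) / x * exp (- s)) has_integral std_cell r x) {0..x}"
proof (cases "x > 0")
  case True
  have "((\<lambda>s. s powr r * exp (- 1 * s) - s powr (r + 1) * exp (- 1 * s) / x
        + ((x - s) powr r * exp (- s) - (x - s) powr (r + 1) * exp (- s) / x))
      has_integral pexp (- 1) r x - pexp (- 1) (r + 1) x / x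
        + (exp (- x) * pexp 1 r x - exp (- x) * pexp 1 (r + 1) x / x)) {0..x}"
    using assms by (intro has_integral_add has_integral_diff has_integral_divide
        pexp_has_integral pexp_reflect_has_integral) auto
  then have "((\<lambda>s. (s powr r * (x - s) + (x - s) powr r * s) / x * exp (- s)) has_integral
      pexp (- 1) r x - pexp (- 1) (r + 1) x / x
        + (exp (- x) * pexp 1 r x - exp (- x) * pexp 1 (r + 1) x / x)) {0..x}"
  proof (rule has_integral_eq[rotated])
    fix s assume "s \<in> {0..x}"
    then have eq: "s powr (r + 1) = s * s powr r"
      "(x - s) powr (r + 1) = x * (x - s) powr r - s * (x - s) powr r"
      using powr_Suc_mult[of s r] powr_Suc_diff[of s x r] by auto
    show "s powr r * exp (- 1 * s) - s powr (r + 1) * exp (- 1 * s) / x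
        + ((x - s) powr r * exp (- s) - (x - s) powr (r + 1) * exp (- s) / x)
      = (s powr r * (x - s) + (x - s) powr r * s) / x * exp (- s)"
      unfolding eq using True by (simp add: field_simps)
  qed
  then show ?thesis by (simp add: std_cell_def algebra_simps)
next
  case False
  then have "std_cell r x = 0" by (cases "x = 0") (simp_all add: std_cell_def pexp_def)
  with False show ?thesis by (cases "x = 0") auto
qed

lemma std_cell_zero [simp]: "std_cell r 0 = 0"
  by (simp add: std_cell_def)

text \<open>Nonnegativity turns gauge integrability into absolute integrability. The interval is
  open because at \<open>r = 1\<close> the factor \<open>(1 - z) powr (r - 1)\<close> of
  \<open>Psi\<close> jumps at \<open>z = 1\<close>.\<close>

lemma set_lebesgue_integral_eq_has_integral:
  fixes f :: "real \<Rightarrow> real"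
  assumes cont: "continuous_on {a<..<b} f"
    and nonneg: "\<And>x. x \<in> {a<..<b} \<Longrightarrow> f x \<ge> 0"
    and int: "(f has_integral I) {a..b}"
  shows "(LINT x:{a<..<b}|lborel. f x) = I"
proof -
  have int': "(f has_integral I) {a<..<b}"
    using int has_integral_open_interval[of f I a b] by simp
  have meas: "(\<lambda>x. indicator {a<..<b} x *\<^sub>R f x) \<in> borel_measurable lborel"
    using borel_measurable_continuous_on_indicator[OF _ cont] by simp
  have ai: "f absolutely_integrable_on {a<..<b}"
    using int' nonneg by (intro nonnegative_absolutely_integrable_1) (auto simp: has_integral_integrable)
  have "(LINT x:{a<..<b}|lborel. f x) = (LINT x:{a<..<b}|lebesgue. f x)"
    unfolding set_lebesgue_integral_def by (rule integral_completion[OF meas, symmetric])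
  also have "\<dots> = integral {a<..<b} f"
    using set_lebesgue_integral_eq_integral(2)[OF ai] .
  also have "\<dots> = I" using int' by (rule integral_unique)
  finally show ?thesis .
qed

lemma Psi_nonneg: "r \<ge> 1 \<Longrightarrow> z \<in> {0<..<1} \<Longrightarrow> Psi r z \<ge> 0"
  unfolding Psi_def by simp

lemma continuous_on_Psi: "continuous_on {0<..<1} (Psi r)"
  unfolding Psi_def[abs_def] by (intro continuous_intros) auto

text \<open>Replacing one factor z of the square by 1 - (1 - z) splits the last summand of
  \<open>Psi\<close>; the coefficient \<open>r - 1\<close> then drops to - 1.\<close>

lemma Psi_eq:
  assumes "z \<in> {0<..<1}"
  shows "Psi r z = z powr (r + 1) + r * z * (1 - z) powr (r - 1) - z * (1 - z) powr r"
proof -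
  have eq: "(1 - z) powr r = (1 - z) * (1 - z) powr (r - 1)"
    using assms powr_Suc_mult[of "1 - z" "r - 1"] by simp
  show ?thesis unfolding Psi_def eq by (simp add: power2_eq_square algebra_simps)
qed

lemma LINT_Psi_exp:
  assumes "r \<ge> 1" "((\<lambda>z. Psi r z * exp (y * z)) has_integral I) {0..1}"
  shows "(LINT z:{0<..<1}|lborel. Psi r z * exp (y * z)) = I"
  using assms Psi_nonneg
  by (intro set_lebesgue_integral_eq_has_integral continuous_intros continuous_on_Psi) auto

text \<open>The closed forms below come from the substitutions \<open>z = 1 - s / x\<close> for \<^const>\<open>Phi\<close> and
  \<open>z = s / x\<close> for \<^const>\<open>Phi_check\<close>; the exponents \<open>r - 1\<close> are removed by partial integration.\<close>

lemma Phi_integrand_has_integral: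
  assumes r: "r \<ge> 1" and x: "x > 0"
  shows "((\<lambda>s. ((x - s) powr (r + 1) / x\<^sup>2 + r * (x - s) * s powr (r - 1) / x - (x - s) * s powr r / x\<^sup>2) * exp (- s))
     has_integral pexp (- 1) r x - pexp (- 1) (r + 1) x / x + pexp (- 1) (r + 1) x / x\<^sup>2
       + exp (- x) * pexp 1 (r + 1) x / x\<^sup>2) {0..x}"
proof -
  have A: "r * pexp (- 1) (r - 1) x = pexp (- 1) r x + x powr r * exp (- x)"
    using pexp_add_one[of "r - 1" x "- 1"] r x by simp
  \<comment> \<open>\<open>A\<close> leaves a boundary term; by \<open>A'\<close> it merges with the
    multiples of \<open>pexp (- 1) r x / x\<close> into
    \<open>- pexp (- 1) (r + 1) x / x\<close>.\<close>
  have A': "pexp (- 1) (r + 1) x = (r + 1) * pexp (- 1) r x - x * x powr r * exp (- x)"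
    using pexp_add_one[of r x "- 1"] r x powr_Suc_mult[of x r] by simp
  have "((\<lambda>s. (x - s) powr (r + 1) * exp (- s) / x\<^sup>2
        + (r * (s powr (r - 1) * exp (- 1 * s)) - r * (s powr r * exp (- 1 * s)) / x)
        - (s powr r * exp (- 1 * s) / x - s powr (r + 1) * exp (- 1 * s) / x\<^sup>2))
      has_integral exp (- x) * pexp 1 (r + 1) x / x\<^sup>2
        + (r * pexp (- 1) (r - 1) x - r * pexp (- 1) r x / x)
        - (pexp (- 1) r x / x - pexp (- 1) (r + 1) x / x\<^sup>2)) {0..x}"
    using r by (intro has_integral_add has_integral_diff has_integral_divide has_integral_mult_right
        pexp_has_integral pexp_reflect_has_integral) auto
  moreover have "exp (- x) * pexp 1 (r + 1) x / x\<^sup>2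
        + (r * pexp (- 1) (r - 1) x - r * pexp (- 1) r x / x)
        - (pexp (- 1) r x / x - pexp (- 1) (r + 1) x / x\<^sup>2)
      = pexp (- 1) r x - pexp (- 1) (r + 1) x / x + pexp (- 1) (r + 1) x / x\<^sup>2
       + exp (- x) * pexp 1 (r + 1) x / x\<^sup>2"
    unfolding A A' using x by (simp add: field_simps power2_eq_square)
  ultimately show ?thesis
  proof (simp only:, elim has_integral_eq[rotated])
    fix s assume "s \<in> {0..x}"
    then have eq: "s powr (r + 1) = s * s powr r" "s powr r = s * s powr (r - 1)"
      using powr_Suc_mult[of s r] powr_Suc_mult[of s "r - 1"] by auto
    show "(x - s) powr (r + 1) * exp (- s) / x\<^sup>2
        + (r * (s powr (r - 1) * exp (- 1 * s)) - r * (s powr r * exp (- 1 * s)) / x)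
        - (s powr r * exp (- 1 * s) / x - s powr (r + 1) * exp (- 1 * s) / x\<^sup>2)
      = ((x - s) powr (r + 1) / x\<^sup>2 + r * (x - s) * s powr (r - 1) / x - (x - s) * s powr r / x\<^sup>2) * exp (- s)"
      unfolding eq using x by (simp add: field_simps power2_eq_square)
  qed
qed

lemma Phi_check_integrand_has_integral:
  assumes r: "r \<ge> 1" and x: "x > 0"
  shows "((\<lambda>s. (s powr (r + 1) / x\<^sup>2 + r * s * (x - s) powr (r - 1) / x - s * (x - s) powr r / x\<^sup>2) * exp (- s))
     has_integral pexp (- 1) (r + 1) x / x\<^sup>2
       + exp (- x) * (pexp 1 (r + 1) x / x\<^sup>2 + pexp 1 (r + 1) x / x - pexp 1 r x)) {0..x}"
proof -
  have "r * pexp 1 (r - 1) x = x powr r * exp x - pexp 1 r x"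
    using pexp_add_one[of "r - 1" x 1] r x by simp
  then have "exp (- x) * (r * pexp 1 (r - 1) x) = exp (- x) * (x powr r * exp x - pexp 1 r x)"
    by simp
  then have B: "r * (exp (- x) * pexp 1 (r - 1) x) = x powr r - exp (- x) * pexp 1 r x"
    by (simp add: exp_minus algebra_simps)
  have B': "pexp 1 (r + 1) x = x * x powr r * exp x - (r + 1) * pexp 1 r x"
    using pexp_add_one[of r x 1] r x powr_Suc_mult[of x r] by simp
  have "((\<lambda>s. s powr (r + 1) * exp (- 1 * s) / x\<^sup>2
        + (r * ((x - s) powr (r - 1) * exp (- s)) - r * ((x - s) powr r * exp (- s)) / x)
        - ((x - s) powr r * exp (- s) / x - (x - s) powr (r + 1) * exp (- s) / x\<^sup>2))
      has_integral pexp (- 1) (r + 1) x / x\<^sup>2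
        + (r * (exp (- x) * pexp 1 (r - 1) x) - r * (exp (- x) * pexp 1 r x) / x)
        - (exp (- x) * pexp 1 r x / x - exp (- x) * pexp 1 (r + 1) x / x\<^sup>2)) {0..x}"
    using r by (intro has_integral_add has_integral_diff has_integral_divide has_integral_mult_right
        pexp_has_integral pexp_reflect_has_integral) auto
  moreover have "pexp (- 1) (r + 1) x / x\<^sup>2
        + (r * (exp (- x) * pexp 1 (r - 1) x) - r * (exp (- x) * pexp 1 r x) / x)
        - (exp (- x) * pexp 1 r x / x - exp (- x) * pexp 1 (r + 1) x / x\<^sup>2)
      = pexp (- 1) (r + 1) x / x\<^sup>2
       + exp (- x) * (pexp 1 (r + 1) x / x\<^sup>2 + pexp 1 (r + 1) x / x - pexp 1 r x)"
    unfolding B B' using x by (simp add: exp_minus field_simps power2_eq_square)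
  ultimately show ?thesis
  proof (simp only:, elim has_integral_eq[rotated])
    fix s assume "s \<in> {0..x}"
    then have eq: "(x - s) powr (r + 1) = x * (x - s) powr r - s * (x - s) powr r"
      "(x - s) powr r = x * (x - s) powr (r - 1) - s * (x - s) powr (r - 1)"
      using powr_Suc_diff[of s x r] powr_Suc_diff[of s x "r - 1"] by auto
    show "s powr (r + 1) * exp (- 1 * s) / x\<^sup>2
        + (r * ((x - s) powr (r - 1) * exp (- s)) - r * ((x - s) powr r * exp (- s)) / x)
        - ((x - s) powr r * exp (- s) / x - (x - s) powr (r + 1) * exp (- s) / x\<^sup>2)
      = (s powr (r + 1) / x\<^sup>2 + r * s * (x - s) powr (r - 1) / x - s * (x - s) powr r / x\<^sup>2) * exp (- s)"
      unfolding eq using x by (simp add: field_simps power2_eq_square)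
  qed
qed

section \<open>Substitution in the integrals that define \<open>Phi\<close> and
  \<open>Phi_check\<close>\<close>

lemma has_integral_rescale_01:
  fixes f :: "real \<Rightarrow> real"
  assumes "(f has_integral I) {0..x}" "x > 0"
  shows "((\<lambda>z. f (x * z)) has_integral I / x) {0..1}"
    and "((\<lambda>z. f (x - x * z)) has_integral I / x) {0..1}"
proof -
  have f: "(f has_integral I) (cbox 0 x)" using assms by simp
  show "((\<lambda>z. f (x * z)) has_integral I / x) {0..1}"
    using has_integral_affinity[OF f, of x 0] image_affinity_cbox[of "1 / x" 0 0 x] assms by simp
  show "((\<lambda>z. f (x - x * z)) has_integral I / x) {0..1}"
    using has_integral_affinity[OF f, of "- x" x] image_affinity_cbox[of "- (1 / x)" 1 0 x] assms
    by (simp add: add.commute)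
qed

text \<open>Homogeneity of degree \<open>r - 1\<close>. The remaining factor x of the power in
  \<open>Phi\<close> comes from the substitution itself.\<close>

lemma Psi_rescale:
  assumes "x > 0" "z \<in> {0<..<1}"
  shows "(x * z) powr (r + 1) / x\<^sup>2 + r * (x * z) * (x * (1 - z)) powr (r - 1) / x
    - x * z * (x * (1 - z)) powr r / x\<^sup>2 = x powr (r - 1) * Psi r z"
proof -
  have eq: "x powr (r + 1) = x * x powr r" "x powr r = x * x powr (r - 1)"
    using assms powr_Suc_mult[of x "r - 1"] powr_Suc_mult[of x r] by simp_all
  have eq': "(x * z) powr (r + 1) = x powr (r + 1) * z powr (r + 1)"
    "(x * (1 - z)) powr (r - 1) = x powr (r - 1) * (1 - z) powr (r - 1)"
    "(x * (1 - z)) powr r = x powr r * (1 - z) powr r"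
    using assms by (auto simp: powr_mult)
  show ?thesis
    unfolding eq' unfolding eq Psi_eq[OF assms(2)]
    using assms by (simp add: field_simps power2_eq_square)
qed

lemma Phi_eq:
  assumes r: "r \<ge> 1" and x: "x > 0"
  shows "Phi r x = pexp (- 1) r x - pexp (- 1) (r + 1) x / x + pexp (- 1) (r + 1) x / x\<^sup>2
    + exp (- x) * pexp 1 (r + 1) x / x\<^sup>2"
    (is "_ = ?I")
proof -
  let ?f = "\<lambda>s. ((x - s) powr (r + 1) / x\<^sup>2 + r * (x - s) * s powr (r - 1) / x - (x - s) * s powr r / x\<^sup>2) * exp (- s)"
  have "((\<lambda>z. ?f (x - x * z)) has_integral ?I / x) (cbox 0 1)"
    using has_integral_rescale_01(2)[OF Phi_integrand_has_integral[OF r x] x] by simp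
  from has_integral_mult_right[OF this, of "x powr (1 - r) * exp x"]
  have "((\<lambda>z. Psi r z * exp (x * z)) has_integral x powr (1 - r) * exp x * (?I / x)) (cbox 0 1)"
  proof (rule has_integral_spike_interior)
    fix z :: real assume z: "z \<in> box 0 1"
    have eq: "x - x * z = x * (1 - z)" "x - x * (1 - z) = x * z" by (simp_all add: algebra_simps)
    have "?f (x - x * z) = x powr (r - 1) * Psi r z * exp (x * z - x)"
      unfolding eq using Psi_rescale[OF x, of z r] z by (simp add: algebra_simps)
    moreover have "x powr (1 - r) * x powr (r - 1) = 1"
      using x by (simp flip: powr_add)
    ultimately show "Psi r z * exp (x * z) = x powr (1 - r) * exp x * ?f (x - x * z)"
      by (simp add: exp_diff)
  qed
  then have "(LINT z:{0<..<1}|lborel. Psi r z * exp (x * z)) = x powr (1 - r) * exp x * (?I / x)"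
    by (intro LINT_Psi_exp r) simp
  then have "Phi r x = (x powr r * x powr (1 - r)) * (exp (- x) * exp x) * ?I / x"
    using x by (simp add: Phi_def)
  also have "\<dots> = ?I" using x by (simp flip: exp_add powr_add)
  finally show ?thesis .
qed

lemma Phi_check_eq_pexp:
  assumes r: "r \<ge> 1" and x: "x > 0"
  shows "Phi_check r x = exp x * (pexp (- 1) (r + 1) x / x\<^sup>2
       + exp (- x) * (pexp 1 (r + 1) x / x\<^sup>2 + pexp 1 (r + 1) x / x - pexp 1 r x))"
    (is "_ = exp x * ?I")
proof -
  let ?f = "\<lambda>s. (s powr (r + 1) / x\<^sup>2 + r * s * (x - s) powr (r - 1) / x - s * (x - s) powr r / x\<^sup>2) * exp (- s)"
  have "((\<lambda>z. ?f (x * z)) has_integral ?I / x) (cbox 0 1)"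
    using has_integral_rescale_01(1)[OF Phi_check_integrand_has_integral[OF r x] x] by simp
  from has_integral_mult_right[OF this, of "x powr (1 - r)"]
  have "((\<lambda>z. Psi r z * exp (- x * z)) has_integral x powr (1 - r) * (?I / x)) (cbox 0 1)"
  proof (rule has_integral_spike_interior)
    fix z :: real assume z: "z \<in> box 0 1"
    have eq: "x - x * z = x * (1 - z)" by (simp add: algebra_simps)
    have "?f (x * z) = x powr (r - 1) * Psi r z * exp (- x * z)"
      unfolding eq using Psi_rescale[OF x, of z r] z by (simp add: algebra_simps)
    moreover have "x powr (1 - r) * x powr (r - 1) = 1"
      using x by (simp flip: powr_add)
    ultimately show "Psi r z * exp (- x * z) = x powr (1 - r) * ?f (x * z)"
      by simp
  qed
  then have "(LINT z:{0<..<1}|lborel. Psi r z * exp (- x * z)) = x powr (1 - r) * (?I / x)"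
    by (intro LINT_Psi_exp r) simp
  then have "Phi_check r x = (x powr r * x powr (1 - r)) * exp x * ?I / x"
    using x by (simp add: Phi_check_def Phi_def)
  also have "\<dots> = exp x * ?I" using x by (simp flip: powr_add)
  finally show ?thesis .
qed

text \<open>Squeezed by \<open>pexp_le\<close>: the quotient is of order
  \<open>x powr (p + 1 - k)\<close>.\<close>

lemma pexp_ratio_tendsto_0:
  fixes k :: nat and p :: real
  assumes "p \<ge> 0" "p + 1 > k"
  shows "((\<lambda>x. pexp c p x / x ^ k) \<longlongrightarrow> 0) (at_right 0)"
proof (rule tendsto_sandwich)
  show "\<forall>\<^sub>F x in at_right 0. 0 \<le> pexp c p x / x ^ k"
    by (auto simp: eventually_at_right_field pexp_nonneg intro!: exI[of _ 1])
  have "pexp c p x / x ^ k \<le> x powr (p + 1 - k) * exp \<bar>c * x\<bar>" if "x > 0" for x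
  proof -
    have "pexp c p x / x ^ k \<le> x * (x powr p * exp \<bar>c * x\<bar>) / x ^ k"
      using that assms by (intro divide_right_mono pexp_le) auto
    also have "\<dots> = x powr (p + 1 - k) * exp \<bar>c * x\<bar>"
      using that powr_Suc_mult[of x p] by (simp add: powr_diff powr_realpow flip: mult.assoc)
    finally show ?thesis .
  qed
  then show "\<forall>\<^sub>F x in at_right 0. pexp c p x / x ^ k \<le> x powr (p + 1 - k) * exp \<bar>c * x\<bar>"
    by (auto simp: eventually_at_right_field intro!: exI[of _ 1])
  have "continuous_on {0..1} (\<lambda>x. x powr (p + 1 - k) * exp \<bar>c * x\<bar>)"
    using assms by (intro continuous_on_mult continuous_on_powr' continuous_intros) auto
  then have "((\<lambda>x. x powr (p + 1 - k) * exp \<bar>c * x\<bar>) \<longlongrightarrow> 0 powr (p + 1 - k) * exp \<bar>c * 0\<bar>)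
      (at 0 within {0..1})"
    unfolding continuous_on_def by (rule bspec) simp
  then show "((\<lambda>x. x powr (p + 1 - k) * exp \<bar>c * x\<bar>) \<longlongrightarrow> 0) (at_right 0)"
    by (simp add: at_within_Icc_at_right)
qed simp

text \<open>The closed forms divide by x, so the point 0 is handled by a one-sided limit
  alone.\<close>

lemma continuous_on_atLeast_0:
  fixes f f' :: "real \<Rightarrow> real"
  assumes "\<And>x. x > 0 \<Longrightarrow> (f has_real_derivative f' x) (at x)" "(f \<longlongrightarrow> f 0) (at_right 0)"
  shows "continuous_on {0..} f"
  unfolding continuous_on_eq_continuous_within
proof
  fix x :: real assume "x \<in> {0..}"
  then consider "x = 0" | "x > 0" by fastforce
  then show "continuous (at x within {0..}) f"
  proof cases
    case 1
    have "at (0::real) within {0..} = at_right 0"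
      using at_within_Ici_at_right by blast
    with assms(2) 1 show ?thesis by (simp add: continuous_within)
  qed (use assms(1) DERIV_isCont continuous_at_imp_continuous_at_within in blast)
qed

subsection \<open>Monotonicity of the partial derivatives\<close>

text \<open>Memorylessness in differential form: shifting both ends of a cell by h multiplies its
  error by exp(-h), so the two partial derivatives of the error add up to its negative. The proof
  compares closed forms.\<close>

lemma Phi_eq_std_cell:
  assumes "r \<ge> 1" "x > 0"
  shows "Phi r x = std_cell r x + exp (- x) * Phi_check r x"
proof -
  have "exp (- x) * Phi_check r x = pexp (- 1) (r + 1) x / x\<^sup>2
       + exp (- x) * (pexp 1 (r + 1) x / x\<^sup>2 + pexp 1 (r + 1) x / x - pexp 1 r x)"
    unfolding Phi_check_eq_pexp[OF assms] by (simp flip: exp_add mult.assoc)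
  then show ?thesis
    unfolding Phi_eq[OF assms] std_cell_def by (simp add: algebra_simps)
qed

text \<open>Arranged so that \<open>pexp_less\<close> makes each bracket positive:
  \<open>2 * pexp c (r + 1) x / x\<close> lies below \<open>2 * pexp c r x\<close>, and
  \<open>2 \<le> r + 1\<close>.\<close>

definition Phi_deriv :: "real \<Rightarrow> real \<Rightarrow> real" where
  "Phi_deriv r x = ((r + 1) * pexp (- 1) r x - 2 * pexp (- 1) (r + 1) x / x
     + exp (- x) * ((r + 1) * pexp 1 r x - 2 * pexp 1 (r + 1) x / x)) / x\<^sup>2"

lemma Phi_deriv_pos:
  assumes r: "r \<ge> 1" and x: "x > 0"
  shows "Phi_deriv r x > 0"
proof -
  have *: "(r + 1) * pexp c r x - 2 * pexp c (r + 1) x / x > 0" for c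
  proof -
    have "2 * pexp c (r + 1) x / x < 2 * pexp c r x"
      using pexp_less[of r x c] r x by (simp add: field_simps)
    also have "\<dots> \<le> (r + 1) * pexp c r x"
      using r pexp_nonneg[of c r x] by (intro mult_right_mono) auto
    finally show ?thesis by simp
  qed
  show ?thesis
    unfolding Phi_deriv_def using x by (intro divide_pos_pos add_pos_pos mult_pos_pos *) auto
qed

text \<open>This ties the integral of \<open>Psi\<close> to the optimization: up to the factor
  \<open>exp (- x)\<close>, \<open>Phi_check\<close> is the derivative of the cell error in its
  length.\<close>

lemma std_cell_has_derivative:
  assumes r: "r \<ge> 1" and x: "x > 0"
  shows "(std_cell r has_real_derivative exp (- x) * Phi_check r x) (at x)"
proof -
  have B: "pexp 1 (r + 1) x = x * x powr r * exp x - (r + 1) * pexp 1 r x"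
    using pexp_add_one[of r x 1] r x powr_Suc_mult[of x r] by simp
  have eq: "x powr (r + 1) = x * x powr r"
    using x powr_Suc_mult[of x r] by simp
  show ?thesis
    unfolding std_cell_def[abs_def] Phi_check_eq_pexp[OF r x]
    apply (rule derivative_eq_intros refl | use r x in \<open>simp; fail\<close>)+
    unfolding B eq using x
    by (simp add: exp_minus field_simps power2_eq_square)
qed

lemma Phi_has_derivative:
  assumes r: "r \<ge> 1" and x: "x > 0"
  shows "(Phi r has_real_derivative Phi_deriv r x) (at x)"
proof -
  have A: "pexp (- 1) (r + 1) x = (r + 1) * pexp (- 1) r x - x * x powr r * exp (- x)"
    using pexp_add_one[of r x "- 1"] r x powr_Suc_mult[of x r] by simp
  have B: "pexp 1 (r + 1) x = x * x powr r * exp x - (r + 1) * pexp 1 r x"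
    using pexp_add_one[of r x 1] r x powr_Suc_mult[of x r] by simp
  have eq: "x powr (r + 1) = x * x powr r"
    using x powr_Suc_mult[of x r] by simp
  have "((\<lambda>x. pexp (- 1) r x - pexp (- 1) (r + 1) x / x + pexp (- 1) (r + 1) x / x\<^sup>2
      + exp (- x) * pexp 1 (r + 1) x / x\<^sup>2) has_real_derivative Phi_deriv r x) (at x)"
    apply (rule derivative_eq_intros refl | use r x in \<open>simp; fail\<close>)+
    unfolding Phi_deriv_def A B eq using x
    by (simp add: exp_minus field_simps power2_eq_square)
  then show ?thesis
    by (rule has_field_derivative_transform_within_open[of _ _ _ "{0<..}"])
      (use x Phi_eq[OF r] in auto)
qed

text \<open>In the derivative of \<open>exp x * (Phi r x - std_cell r x)\<close> the product itself
  equals \<open>Phi_check r x\<close> and cancels against \<open>exp x\<close> times the derivative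
  of \<open>std_cell\<close>.\<close>

lemma Phi_check_has_derivative:
  assumes r: "r \<ge> 1" and x: "x > 0"
  shows "(Phi_check r has_real_derivative exp x * Phi_deriv r x) (at x)"
proof -
  have "((\<lambda>x. exp x * (Phi r x - std_cell r x)) has_real_derivative
      exp x * Phi_deriv r x) (at x)"
    by (rule derivative_eq_intros Phi_has_derivative std_cell_has_derivative r x refl)+
      (use Phi_eq_std_cell[OF r x] in \<open>simp add: algebra_simps\<close>)
  then show ?thesis
    by (rule has_field_derivative_transform_within_open[of _ _ _ "{0<..}"])
      (use x Phi_eq_std_cell[OF r] in \<open>auto simp: exp_minus field_simps\<close>)
qed

section \<open>Values at 0, continuity and strict monotonicity on the closed half line\<close>

lemma Phi_zero [simp]: "Phi r 0 = 0"
  by (simp add: Phi_def)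

lemma Phi_check_zero [simp]: "Phi_check r 0 = 0"
  by (simp add: Phi_check_def)

lemma std_cell_tendsto_0:
  assumes "r \<ge> 1"
  shows "(std_cell r \<longlongrightarrow> 0) (at_right 0)"
proof -
  have "(std_cell r \<longlongrightarrow> 0 - 0 + exp (- 0) * (0 - 0)) (at_right 0)"
    unfolding std_cell_def[abs_def]
    using assms pexp_ratio_tendsto_0[of r 0] pexp_ratio_tendsto_0[of "r + 1" 1]
    by (intro tendsto_add tendsto_diff tendsto_mult tendsto_exp tendsto_minus tendsto_ident_at) auto
  then show ?thesis by simp
qed

lemma Phi_tendsto_0:
  assumes "r \<ge> 1"
  shows "(Phi r \<longlongrightarrow> 0) (at_right 0)"
proof -
  have "((\<lambda>x. pexp (- 1) r x - pexp (- 1) (r + 1) x / x + pexp (- 1) (r + 1) x / x\<^sup>2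
      + exp (- x) * (pexp 1 (r + 1) x / x\<^sup>2)) \<longlongrightarrow> 0 - 0 + 0 + exp (- 0) * 0) (at_right 0)"
    using pexp_ratio_tendsto_0[of r 0] pexp_ratio_tendsto_0[of "r + 1" 1]
      pexp_ratio_tendsto_0[of "r + 1" 2] assms
    by (intro tendsto_add tendsto_diff tendsto_mult tendsto_exp tendsto_minus tendsto_ident_at) auto
  then have "((\<lambda>x. pexp (- 1) r x - pexp (- 1) (r + 1) x / x + pexp (- 1) (r + 1) x / x\<^sup>2
      + exp (- x) * (pexp 1 (r + 1) x / x\<^sup>2)) \<longlongrightarrow> 0) (at_right 0)"
    by simp
  moreover have "\<forall>\<^sub>F x in at_right 0. pexp (- 1) r x - pexp (- 1) (r + 1) x / x
      + pexp (- 1) (r + 1) x / x\<^sup>2 + exp (- x) * (pexp 1 (r + 1) x / x\<^sup>2) = Phi r x"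
    using Phi_eq[OF assms] by (auto simp: eventually_at_right_field intro!: exI[of _ 1])
  ultimately show ?thesis using tendsto_cong by fast
qed

lemma Phi_check_tendsto_0:
  assumes "r \<ge> 1"
  shows "(Phi_check r \<longlongrightarrow> 0) (at_right 0)"
proof -
  have "((\<lambda>x. exp x * (Phi r x - std_cell r x)) \<longlongrightarrow> 0) (at_right 0)"
    using assms by (auto intro!: tendsto_eq_intros Phi_tendsto_0 std_cell_tendsto_0)
  moreover have "\<forall>\<^sub>F x in at_right 0. exp x * (Phi r x - std_cell r x) = Phi_check r x"
    using Phi_eq_std_cell[OF assms]
    by (auto simp: eventually_at_right_field exp_minus field_simps intro!: exI[of _ 1])
  ultimately show ?thesis using tendsto_cong by fast
qed

lemma continuous_on_std_cell: "r \<ge> 1 \<Longrightarrow> continuous_on {0..} (std_cell r)"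
  using std_cell_has_derivative std_cell_tendsto_0 by (intro continuous_on_atLeast_0) auto

lemma continuous_on_Phi: "r \<ge> 1 \<Longrightarrow> continuous_on {0..} (Phi r)"
  using Phi_has_derivative Phi_tendsto_0 by (intro continuous_on_atLeast_0) auto

lemma continuous_on_Phi_check: "r \<ge> 1 \<Longrightarrow> continuous_on {0..} (Phi_check r)"
  using Phi_check_has_derivative Phi_check_tendsto_0 by (intro continuous_on_atLeast_0) auto

lemma strict_mono_on_atLeast_0:
  fixes f f' :: "real \<Rightarrow> real"
  assumes "continuous_on {0..} f" "\<And>x. x > 0 \<Longrightarrow> (f has_real_derivative f' x) (at x)"
    "\<And>x. x > 0 \<Longrightarrow> f' x > 0"
  shows "strict_mono_on {0..} f"
proof (rule strict_mono_onI)
  fix x y :: real assume "x \<in> {0..}" "y \<in> {0..}" "x < y"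
  moreover from this have "\<exists>d. (f has_real_derivative d) (at t) \<and> d > 0" if "x < t" for t
    using assms(2,3)[of t] that by auto
  ultimately show "f x < f y"
    using continuous_on_subset[OF assms(1), of "{x..y}"]
    by (intro DERIV_pos_imp_increasing_open[of x y f]) auto
qed

lemma strict_mono_on_Phi: "r \<ge> 1 \<Longrightarrow> strict_mono_on {0..} (Phi r)"
  by (rule strict_mono_on_atLeast_0[OF continuous_on_Phi Phi_has_derivative Phi_deriv_pos])

lemma strict_mono_on_Phi_check: "r \<ge> 1 \<Longrightarrow> strict_mono_on {0..} (Phi_check r)"
  by (rule strict_mono_on_atLeast_0[OF continuous_on_Phi_check Phi_check_has_derivative])
    (auto simp: Phi_deriv_pos)

lemma Phi_pos: "r \<ge> 1 \<Longrightarrow> x > 0 \<Longrightarrow> Phi r x > 0"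
  using strict_mono_onD[OF strict_mono_on_Phi, of r 0 x] by simp

section \<open>Ranges of the partial derivatives\<close>

lemma increasing_bij_atLeast_0:
  assumes f: "continuous_on {0..} f" "strict_mono_on {0..} f" "f 0 = 0"
    and unbdd: "\<And>y. \<exists>x\<ge>0. f x \<ge> y"
  shows "increasing_bij f {0..} {0..}"
proof -
  have "f ` {0..} = {0..}"
  proof safe
    fix x :: real assume "x \<ge> 0"
    then show "f x \<ge> 0" using f(2,3) strict_mono_on_leD[of "{0..}" f 0 x] by simp
  next
    fix y :: real assume y: "y \<ge> 0"
    obtain x where "x \<ge> 0" "f x \<ge> y" using unbdd by blast
    then have "\<exists>z. 0 \<le> z \<and> z \<le> x \<and> f z = y"
      using f y by (intro IVT') (auto intro: continuous_on_subset)
    then show "y \<in> f ` {0..}" by auto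
  qed
  then show ?thesis
    using f(2) by (simp add: increasing_bij_def bij_betw_def strict_mono_on_imp_inj_on)
qed

text \<open>Only the summand of \<open>z powr (r + 1)\<close> in \<open>Psi\<close> is kept. Its
  integral is at least \<open>k\<close> once \<open>x \<ge> 1\<close>, and the factor
  \<open>exp x / x\<^sup>2\<close> in front of it diverges.\<close>

lemma Phi_check_unbounded:
  assumes r: "r \<ge> 1"
  shows "\<exists>x\<ge>0. Phi_check r x \<ge> y"
proof -
  define k where "k = pexp (- 1) (r + 1) 1"
  have k: "k > 0" unfolding k_def using r by (intro pexp_pos) auto
  have le: "exp x / x\<^sup>2 * k \<le> Phi_check r x" if x: "x \<ge> 1" for x
  proof -
    have "k \<le> pexp (- 1) (r + 1) x"
      unfolding k_def pexp_def using r x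
      by (intro integral_subset_le pexp_integrand_integrable) auto
    moreover have "pexp (- 1) (r + 1) x / x\<^sup>2 \<le> pexp (- 1) (r + 1) x / x\<^sup>2
       + exp (- x) * (pexp 1 (r + 1) x / x\<^sup>2 + pexp 1 (r + 1) x / x - pexp 1 r x)"
    proof (rule has_integral_le[OF _ Phi_check_integrand_has_integral[OF r]])
      show "((\<lambda>s. s powr (r + 1) * exp (- 1 * s) / x\<^sup>2) has_integral pexp (- 1) (r + 1) x / x\<^sup>2) {0..x}"
        using r by (intro has_integral_divide pexp_has_integral) auto
      fix s assume s: "s \<in> {0..x}"
      \<comment> \<open>The negative summand is the positive one before it times (x - s) / (r x),
        which is at most 1; so the two together may be dropped.\<close>
      have "(x - s) powr r = (x - s) powr (r - 1) * (x - s)"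
        using s powr_Suc_mult[of "x - s" "r - 1"] by (simp add: mult.commute)
      then have "s * (x - s) powr r / x\<^sup>2 = s * (x - s) powr (r - 1) / x * ((x - s) / x)"
        by (simp add: power2_eq_square)
      also have "(x - s) / x \<le> 1" using s x by (simp add: field_simps)
      then have "(x - s) / x \<le> r" using r by linarith
      then have "s * (x - s) powr (r - 1) / x * ((x - s) / x) \<le> s * (x - s) powr (r - 1) / x * r"
        using s x r by (intro mult_left_mono) auto
      finally have "(s powr (r + 1) / x\<^sup>2 + 0) * exp (- s) \<le> (s powr (r + 1) / x\<^sup>2
          + (r * s * (x - s) powr (r - 1) / x - s * (x - s) powr r / x\<^sup>2)) * exp (- s)"
        by (intro mult_right_mono add_left_mono) (simp_all add: algebra_simps)
      then show "s powr (r + 1) * exp (- 1 * s) / x\<^sup>2 \<le> (s powr (r + 1) / x\<^sup>2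
          + r * s * (x - s) powr (r - 1) / x - s * (x - s) powr r / x\<^sup>2) * exp (- s)"
        by (simp add: algebra_simps)
    qed (use x in auto)
    ultimately have "k / x\<^sup>2 \<le> pexp (- 1) (r + 1) x / x\<^sup>2
       + exp (- x) * (pexp 1 (r + 1) x / x\<^sup>2 + pexp 1 (r + 1) x / x - pexp 1 r x)"
      by (meson divide_right_mono order_trans zero_le_power2)
    from mult_left_mono[OF this, of "exp x"] show ?thesis
      using Phi_check_eq_pexp[OF r, of x] x by simp
  qed
  have "filterlim (\<lambda>x. exp x / x\<^sup>2 * k) at_top at_top"
    using k by real_asymp
  then have "\<forall>\<^sub>F x in at_top. exp x / x\<^sup>2 * k \<ge> y \<and> x \<ge> 1"
    by (simp add: filterlim_at_top eventually_conj_iff eventually_ge_at_top)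
  then obtain x where "exp x / x\<^sup>2 * k \<ge> y" "x \<ge> 1"
    using eventually_happens'[OF trivial_limit_at_top_linorder] by fast
  with le[of x] show ?thesis by (intro exI[of _ x]) auto
qed

lemma increasing_bij_Phi_check: "r \<ge> 1 \<Longrightarrow> increasing_bij (Phi_check r) {0..} {0..}"
  by (intro increasing_bij_atLeast_0 continuous_on_Phi_check strict_mono_on_Phi_check
      Phi_check_unbounded) auto

subsection \<open>The exponents one and two\<close>

lemma pexp_explicit:
  assumes "x \<ge> 0"
  shows "pexp (- 1) 1 x = 1 - (x + 1) * exp (- x)"
    and "pexp (- 1) 2 x = 2 - (x\<^sup>2 + 2 * x + 2) * exp (- x)"
    and "pexp (- 1) 3 x = 6 - (x ^ 3 + 3 * x\<^sup>2 + 6 * x + 6) * exp (- x)"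
    and "pexp 1 1 x = (x - 1) * exp x + 1"
    and "pexp 1 2 x = (x\<^sup>2 - 2 * x + 2) * exp x - 2"
    and "pexp 1 3 x = (x ^ 3 - 3 * x\<^sup>2 + 6 * x - 6) * exp x + 6"
proof -
  \<comment> \<open>The spike removes the left endpoint, where \<open>s powr 0\<close> is 0 instead
    of 1.\<close>
  have 0: "c * pexp c 0 x = exp (c * x) - 1" for c
  proof -
    have "((\<lambda>s. c * exp (c * s)) has_integral exp (c * x) - exp (c * 0)) (cbox 0 x)"
      using assms
      by (intro fundamental_theorem_of_calculus[of 0 x "\<lambda>s. exp (c * s)", folded box_real(2)])
        (auto intro!: derivative_eq_intros simp flip: has_real_derivative_iff_has_vector_derivative)
    then have "((\<lambda>s. c * (s powr 0 * exp (c * s))) has_integral exp (c * x) - exp (c * 0)) (cbox 0 x)"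
      by (rule has_integral_spike_interior) auto
    then have "((\<lambda>s. c * (s powr 0 * exp (c * s))) has_integral exp (c * x) - 1) (cbox 0 x)"
      by simp
    moreover have "((\<lambda>s. c * (s powr 0 * exp (c * s))) has_integral c * pexp c 0 x) (cbox 0 x)"
      using pexp_has_integral[of 0 c x] by (intro has_integral_mult_right) auto
    ultimately show ?thesis by (rule has_integral_unique[symmetric])
  qed
  show *: "pexp (- 1) 1 x = 1 - (x + 1) * exp (- x)" "pexp 1 1 x = (x - 1) * exp x + 1"
    using 0[of "-1"] 0[of 1] pexp_add_one[of 0 x "-1"] pexp_add_one[of 0 x 1] assms
    by (simp_all add: algebra_simps)
  show **: "pexp (- 1) 2 x = 2 - (x\<^sup>2 + 2 * x + 2) * exp (- x)"
      "pexp 1 2 x = (x\<^sup>2 - 2 * x + 2) * exp x - 2"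
    using * pexp_add_one[of 1 x "-1"] pexp_add_one[of 1 x 1] assms
    by (simp_all add: algebra_simps)
  show "pexp (- 1) 3 x = 6 - (x ^ 3 + 3 * x\<^sup>2 + 6 * x + 6) * exp (- x)"
      "pexp 1 3 x = (x ^ 3 - 3 * x\<^sup>2 + 6 * x - 6) * exp x + 6"
    using ** pexp_add_one[of 2 x "-1"] pexp_add_one[of 2 x 1] assms
    by (simp_all add: algebra_simps)
qed

lemma exp_minus_pexp_explicit:
  assumes "x \<ge> 0"
  shows "exp (- x) * pexp 1 2 x = x\<^sup>2 - 2 * x + 2 - 2 * exp (- x)"
    and "exp (- x) * pexp 1 3 x = x ^ 3 - 3 * x\<^sup>2 + 6 * x - 6 + 6 * exp (- x)"
proof -
  have E: "exp (- x) * (p * exp x + q) = p + q * exp (- x)" for p q :: real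
    by (simp add: exp_minus field_simps)
  show "exp (- x) * pexp 1 2 x = x\<^sup>2 - 2 * x + 2 - 2 * exp (- x)"
    "exp (- x) * pexp 1 3 x = x ^ 3 - 3 * x\<^sup>2 + 6 * x - 6 + 6 * exp (- x)"
    using E[of "x\<^sup>2 - 2 * x + 2" "- 2"] E[of "x ^ 3 - 3 * x\<^sup>2 + 6 * x - 6" 6]
    by (simp_all add: pexp_explicit assms)
qed

lemma Phi_2_eq:
  assumes "x > 0"
  shows "Phi 2 x = x - 1 + exp (- x)"
proof -
  have "Phi 2 x = pexp (- 1) 2 x - pexp (- 1) 3 x / x + pexp (- 1) 3 x / x\<^sup>2
      + exp (- x) * pexp 1 3 x / x\<^sup>2"
    using assms by (simp add: Phi_eq)
  also have "\<dots> = x - 1 + exp (- x)"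
    using assms unfolding exp_minus_pexp_explicit(2)[OF less_imp_le[OF assms]]
    by (simp add: pexp_explicit field_simps power2_eq_square power3_eq_cube)
  finally show ?thesis .
qed

lemma Phi_1_eq:
  assumes "x > 0"
  shows "Phi 1 x = 2 - 4 / x + 4 / x\<^sup>2 - 4 * exp (- x) / x\<^sup>2"
proof -
  have "Phi 1 x = pexp (- 1) 1 x - pexp (- 1) 2 x / x + pexp (- 1) 2 x / x\<^sup>2
      + exp (- x) * pexp 1 2 x / x\<^sup>2"
    using assms by (simp add: Phi_eq)
  also have "\<dots> = 2 - 4 / x + 4 / x\<^sup>2 - 4 * exp (- x) / x\<^sup>2"
    using assms unfolding exp_minus_pexp_explicit(1)[OF less_imp_le[OF assms]]
    by (simp add: pexp_explicit field_simps power2_eq_square)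
  finally show ?thesis .
qed

lemma increasing_bij_Phi_2: "increasing_bij (Phi 2) {0..} {0..}"
proof (intro increasing_bij_atLeast_0 continuous_on_Phi strict_mono_on_Phi)
  fix y :: real
  show "\<exists>x\<ge>0. Phi 2 x \<ge> y"
    \<comment> \<open>By \<open>Phi_2_eq\<close> the value at this point is \<bar>y\<bar> plus an
      exponential.\<close>
    by (intro exI[of _ "\<bar>y\<bar> + 1"]) (simp add: Phi_2_eq add_increasing2)
qed auto

lemma increasing_bij_Phi_1: "increasing_bij (Phi 1) {0<..} {0<..<2}"
proof -
  have mono: "strict_mono_on {0..} (Phi 1)" by (simp add: strict_mono_on_Phi)
  have "((\<lambda>x::real. 2 - 4 / x + 4 / x\<^sup>2 - 4 * exp (- x) / x\<^sup>2) \<longlongrightarrow> 2) at_top"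
    by real_asymp
  moreover have "\<forall>\<^sub>F x in at_top. 2 - 4 / x + 4 / x\<^sup>2 - 4 * exp (- x) / x\<^sup>2 = Phi 1 x"
    using eventually_gt_at_top[of 0] by eventually_elim (simp add: Phi_1_eq)
  ultimately have lim: "(Phi 1 \<longlongrightarrow> 2) at_top" using tendsto_cong by fast
  have lt: "Phi 1 x < 2" if "x > 0" for x
  proof -
    \<comment> \<open>The detour through \<open>x + 1\<close> gives strictness; the limit bounds
      values only weakly.\<close>
    have "Phi 1 x < Phi 1 (x + 1)" using strict_mono_onD[OF mono, of x "x + 1"] that by simp
    also have "\<forall>\<^sub>F y in at_top. Phi 1 (x + 1) \<le> Phi 1 y"
      using eventually_ge_at_top[of "x + 1"]
      by eventually_elim (use strict_mono_on_leD[OF mono, of "x + 1"] that in auto)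
    then have "Phi 1 (x + 1) \<le> 2"
      using tendsto_lowerbound[OF lim] by simp
    finally show ?thesis .
  qed
  have "Phi 1 ` {0<..} = {0<..<2}"
  proof safe
    fix x :: real assume "x > 0"
    then show "Phi 1 x \<in> {0<..<2}" using lt Phi_pos by simp
  next
    fix y :: real assume y: "y \<in> {0<..<2}"
    then have "\<forall>\<^sub>F x in at_top. Phi 1 x > y \<and> x > 0"
      using order_tendstoD(1)[OF lim] by (simp add: eventually_conj_iff eventually_gt_at_top)
    then obtain x where "Phi 1 x > y" "x > 0"
      using eventually_happens'[OF trivial_limit_at_top_linorder] by fast
    then have "\<exists>z. 0 \<le> z \<and> z \<le> x \<and> Phi 1 z = y"
      using y by (intro IVT' continuous_on_subset[OF continuous_on_Phi]) auto
    then obtain z where "0 \<le> z" "Phi 1 z = y" by auto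
    moreover from this y have "z \<noteq> 0" by auto
    ultimately show "y \<in> Phi 1 ` {0<..}" by auto
  qed
  moreover have "strict_mono_on {0<..} (Phi 1)"
    using mono by (rule monotone_on_subset) auto
  ultimately show ?thesis
    by (simp add: increasing_bij_def bij_betw_def strict_mono_on_imp_inj_on)
qed

lemma increasing_bij_Phi_check_Ioi:
  assumes "r \<ge> 1"
  shows "increasing_bij (Phi_check r) {0<..} {0<..}"
proof -
  have "bij_betw (Phi_check r) ({0..} - {0}) ({0..} - {Phi_check r 0})"
    using increasing_bij_Phi_check[OF assms]
    by (intro bij_betw_DiffI) (auto simp: increasing_bij_def bij_betw_def)
  moreover have "{0..} - {0::real} = {0<..}" by auto
  ultimately have "bij_betw (Phi_check r) {0<..} {0<..}" by simp
  moreover have "strict_mono_on {0<..} (Phi_check r)"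
    using strict_mono_on_Phi_check[OF assms] by (rule monotone_on_subset) auto
  ultimately show ?thesis by (simp add: increasing_bij_def)
qed

subsection \<open>Iterates of monotone maps\<close>

lemma funpow_atLeast_0:
  fixes T :: "real \<Rightarrow> real"
  assumes "\<And>x. x \<ge> 0 \<Longrightarrow> T x \<ge> 0" "x \<ge> 0"
  shows "(T ^^ k) x \<ge> 0"
  by (induction k) (use assms in auto)

lemma funpow_strict_mono_atLeast_0:
  fixes T :: "real \<Rightarrow> real"
  assumes "strict_mono_on {0..} T" "\<And>x. x \<ge> 0 \<Longrightarrow> T x \<ge> 0" "x \<ge> 0" "x < y"
  shows "(T ^^ k) x < (T ^^ k) y"
proof (induction k)
  case (Suc k)
  then show ?case
    using assms funpow_atLeast_0[of T x k] funpow_atLeast_0[of T y k]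
    by (auto intro: strict_mono_onD)
qed (use assms in auto)

text \<open>Each iterate, hence the nonempty sum, is strictly increasing in the starting
  point.\<close>

lemma iterate_sum_inj:
  fixes T :: "real \<Rightarrow> real"
  assumes T: "strict_mono_on {0..} T" "\<And>x. x \<ge> 0 \<Longrightarrow> T x \<ge> 0"
    and "n > 0" "x \<ge> 0" "y \<ge> 0"
    and eq: "(\<Sum>k<n. (T ^^ k) x) = (\<Sum>k<n. (T ^^ k) y)"
  shows "x = y"
proof -
  have "(\<Sum>k<n. (T ^^ k) u) < (\<Sum>k<n. (T ^^ k) v)" if "0 \<le> u" "u < v" for u v
    using \<open>n > 0\<close> funpow_strict_mono_atLeast_0[OF T that] by (intro sum_strict_mono) auto
  from this[of x y] this[of y x] \<open>x \<ge> 0\<close> \<open>y \<ge> 0\<close> eq show ?thesis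
    by (cases x y rule: linorder_cases) auto
qed

subsection \<open>The map \<open>theta_tilde\<close>\<close>

lemma inv_into_strict_mono_on:
  fixes f :: "real \<Rightarrow> real"
  assumes "strict_mono_on A f" "y \<in> f ` A" "z \<in> f ` A" "y < z"
  shows "inv_into A f y < inv_into A f z"
proof (rule ccontr)
  assume "\<not> inv_into A f y < inv_into A f z"
  then have "f (inv_into A f z) \<le> f (inv_into A f y)"
    using assms by (intro strict_mono_on_leD[OF assms(1)] inv_into_into) auto
  with assms show False by (simp add: f_inv_into_f)
qed

lemma strict_mono_on_inv_into_comp:
  fixes f g :: "real \<Rightarrow> real"
  assumes f: "increasing_bij f {0..} {0..}" and g: "strict_mono_on {0..} g" "g 0 = 0"
  shows "strict_mono_on {0..} (\<lambda>x. inv_into {0..} f (g x))"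
    and "x \<ge> 0 \<Longrightarrow> inv_into {0..} f (g x) \<ge> 0"
proof -
  have im: "f ` {0..} = {0..}" "strict_mono_on {0..} f"
    using f by (auto simp: increasing_bij_def bij_betw_def)
  have g0: "g x \<in> f ` {0..}" if "x \<ge> 0" for x
    using strict_mono_on_leD[OF g(1), of 0 x] g(2) that im by simp
  show "strict_mono_on {0..} (\<lambda>x. inv_into {0..} f (g x))"
    using g0 strict_mono_onD[OF g(1)]
    by (intro strict_mono_onI inv_into_strict_mono_on im) auto
  show "x \<ge> 0 \<Longrightarrow> inv_into {0..} f (g x) \<ge> 0"
    using inv_into_into[OF g0] by simp
qed

lemma strict_mono_on_theta_tilde: "r \<ge> 1 \<Longrightarrow> strict_mono_on {0..} (theta_tilde r)"
  unfolding theta_tilde_def[abs_def]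
  by (intro strict_mono_on_inv_into_comp increasing_bij_Phi_check strict_mono_on_Phi) auto

lemma theta_tilde_nonneg: "r \<ge> 1 \<Longrightarrow> x \<ge> 0 \<Longrightarrow> theta_tilde r x \<ge> 0"
  unfolding theta_tilde_def
  by (intro strict_mono_on_inv_into_comp increasing_bij_Phi_check strict_mono_on_Phi) auto

lemma theta_tilde_eqI:
  assumes "r \<ge> 1" "x \<ge> 0" "Phi_check r x = Phi r y"
  shows "theta_tilde r y = x"
  unfolding theta_tilde_def assms(3)[symmetric]
  using assms strict_mono_on_Phi_check by (intro inv_into_f_f strict_mono_on_imp_inj_on) auto

lemma theta_tilde_zero: "r \<ge> 1 \<Longrightarrow> theta_tilde r 0 = 0"
  by (rule theta_tilde_eqI) auto

subsection \<open>Optimal placement of a single point\<close>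

definition cell :: "real \<Rightarrow> real \<Rightarrow> real \<Rightarrow> real" where
  "cell r u v = exp (- u) * std_cell r (v - u)"

text \<open>The two-cell error has derivative \<open>exp (- y) * \<psi> y\<close> with \<psi>
  strictly increasing, so it falls strictly up to the zero of \<psi> and rises strictly after it. A
  minimum over the closed interval is that zero, also when it lies at an end.\<close>

lemma cell_split_minimum:
  assumes r: "r \<ge> 1" and m: "u \<le> m" "m \<le> v"
    and min: "\<And>y. u \<le> y \<Longrightarrow> y \<le> v \<Longrightarrow> cell r u m + cell r m v \<le> cell r u y + cell r y v"
  shows "Phi_check r (m - u) = Phi r (v - m)"
proof -
  define D where "D = (\<lambda>y. cell r u y + cell r y v)"
  define \<psi> where "\<psi> = (\<lambda>y. Phi_check r (y - u) - Phi r (v - y))"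
  have contD: "continuous_on {u..v} D"
    unfolding D_def cell_def
    by (intro continuous_intros continuous_on_compose2[OF continuous_on_std_cell[OF r]]) auto
  have derivD: "(D has_real_derivative exp (- y) * \<psi> y) (at y)" if "u < y" "y < v" for y
  proof -
    have "((\<lambda>y. cell r u y) has_real_derivative exp (- u) * (exp (- (y - u)) * Phi_check r (y - u) * 1)) (at y)"
      unfolding cell_def using that
      by (intro DERIV_cmult DERIV_chain2[OF std_cell_has_derivative[OF r]])
        (auto intro!: derivative_eq_intros)
    moreover have "((\<lambda>y. cell r y v) has_real_derivative
        exp (- y) * (- 1) * std_cell r (v - y) + exp (- (v - y)) * Phi_check r (v - y) * (- 1) * exp (- y)) (at y)"
      unfolding cell_def using that
      by (intro DERIV_mult DERIV_chain2[OF std_cell_has_derivative[OF r]])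
        (auto intro!: derivative_eq_intros)
    ultimately have "(D has_real_derivative exp (- u) * (exp (- (y - u)) * Phi_check r (y - u) * 1) +
        (exp (- y) * (- 1) * std_cell r (v - y) + exp (- (v - y)) * Phi_check r (v - y) * (- 1) * exp (- y))) (at y)"
      unfolding D_def by (rule DERIV_add)
    moreover have "exp (- u) * (exp (- (y - u)) * Phi_check r (y - u) * 1) = exp (- y) * Phi_check r (y - u)"
      by (simp flip: exp_add mult.assoc)
    ultimately have "(D has_real_derivative exp (- y) * Phi_check r (y - u) +
        (exp (- y) * (- 1) * std_cell r (v - y) + exp (- (v - y)) * Phi_check r (v - y) * (- 1) * exp (- y))) (at y)"
      by (simp only:)
    \<comment> \<open>\<open>Phi_eq_std_cell\<close> merges the last two terms into
      \<open>- exp (- y) * Phi r (v - y)\<close>.\<close>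
    then show ?thesis
      using Phi_eq_std_cell[OF r, of "v - y"] that by (simp add: \<psi>_def algebra_simps)
  qed
  have mono: "\<psi> x < \<psi> y" if "u \<le> x" "x < y" "y \<le> v" for x y
    using that strict_mono_onD[OF strict_mono_on_Phi_check[OF r], of "x - u" "y - u"]
      strict_mono_onD[OF strict_mono_on_Phi[OF r], of "v - y" "v - x"]
    by (simp add: \<psi>_def)
  \<comment> \<open>At the ends one term vanishes, leaving \<open>- Phi r (v - u)\<close> and
    \<open>Phi_check r (v - u)\<close>.\<close>
  have "\<psi> u \<le> 0" "0 \<le> \<psi> v"
    using strict_mono_on_leD[OF strict_mono_on_Phi_check[OF r], of 0 "v - u"]
      strict_mono_on_leD[OF strict_mono_on_Phi[OF r], of 0 "v - u"] m
    by (auto simp: \<psi>_def)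
  moreover have "continuous_on {u..v} \<psi>"
    unfolding \<psi>_def
    by (intro continuous_intros continuous_on_compose2[OF continuous_on_Phi_check[OF r]]
        continuous_on_compose2[OF continuous_on_Phi[OF r]]) auto
  ultimately obtain z where z: "u \<le> z" "z \<le> v" "\<psi> z = 0"
    using IVT'[of \<psi> u 0 v] m by auto
  have le: "D m \<le> D z" using min[of z] z by (simp add: D_def)
  have "m = z"
  proof (rule ccontr)
    assume "m \<noteq> z"
    then consider "m < z" | "z < m" by linarith
    then show False
    proof cases
      case 1
      have "D m > D z"
      proof (rule DERIV_neg_imp_decreasing_open[OF 1])
        fix y assume "m < y" "y < z"
        then show "\<exists>d. (D has_real_derivative d) (at y) \<and> d < 0"
          using derivD[of y] mono[of y z] m z by (auto simp: mult_less_0_iff)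
      qed (use contD m z in \<open>auto intro: continuous_on_subset\<close>)
      with le show False by simp
    next
      case 2
      have "D z < D m"
      proof (rule DERIV_pos_imp_increasing_open[OF 2])
        fix y assume "z < y" "y < m"
        then show "\<exists>d. (D has_real_derivative d) (at y) \<and> d > 0"
          using derivD[of y] mono[of z y] m z by (auto simp: zero_less_mult_iff)
      qed (use contD m z in \<open>auto intro: continuous_on_subset\<close>)
      with le show False by simp
    qed
  qed
  then show ?thesis using z(3) by (simp add: \<psi>_def)
qed

subsection \<open>Optimal sequences of points\<close>

text \<open>Sequences may repeat points and are padded with the right endpoint, which makes the set
  of admissible sequences compact in the product topology.\<close>

definition grid_seqs :: "nat \<Rightarrow> real \<Rightarrow> (nat \<Rightarrow> real) set" where
  "grid_seqs n b = {x. x 0 = 0 \<and> (\<forall>i. x i \<le> x (Suc i)) \<and> (\<forall>i\<ge>n. x i = b)}"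

definition seq_error :: "real \<Rightarrow> nat \<Rightarrow> (nat \<Rightarrow> real) \<Rightarrow> real" where
  "seq_error r n x = (\<Sum>i<n. cell r (x i) (x (Suc i)))"

definition stationary :: "real \<Rightarrow> nat \<Rightarrow> (nat \<Rightarrow> real) \<Rightarrow> bool" where
  "stationary r n x \<longleftrightarrow>
     (\<forall>i. Suc i < n \<longrightarrow> Phi_check r (x (Suc i) - x i) = Phi r (x (Suc (Suc i)) - x (Suc i)))"

lemma grid_seqs_mono: "x \<in> grid_seqs n b \<Longrightarrow> i \<le> j \<Longrightarrow> x i \<le> x j"
  unfolding grid_seqs_def by (rule lift_Suc_mono_le[of x]) auto

lemma grid_seqs_bounds:
  assumes "x \<in> grid_seqs n b"
  shows "0 \<le> x i" "x i \<le> b"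
proof -
  have "x 0 = 0" "x (max i n) = b" using assms by (simp_all add: grid_seqs_def)
  then show "0 \<le> x i" "x i \<le> b"
    using grid_seqs_mono[OF assms, of 0 i] grid_seqs_mono[OF assms, of i "max i n"] by simp_all
qed

text \<open>Tychonoff: a closed subset of a product of copies of \<open>{0..b}\<close>.\<close>

lemma compact_grid_seqs: "compact (grid_seqs n b)"
proof -
  have "compactin (product_topology (\<lambda>_. euclidean) UNIV) (PiE UNIV (\<lambda>_::nat. {0..b}))"
    by (subst compactin_PiE) auto
  then have "compact (PiE UNIV (\<lambda>_::nat. {0..b}))"
    by (simp add: euclidean_product_topology)
  moreover have "closed (grid_seqs n b)"
    unfolding grid_seqs_def
    by (intro closed_Collect_conj closed_Collect_all closed_Collect_eq closed_Collect_le
        closed_Collect_imp continuous_on_product_coordinates continuous_intros) auto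
  moreover have "grid_seqs n b \<subseteq> PiE UNIV (\<lambda>_. {0..b})"
    using grid_seqs_bounds by auto
  ultimately show ?thesis
    using compact_Int_closed[of "PiE UNIV (\<lambda>_::nat. {0..b})" "grid_seqs n b"]
    by (simp add: inf.absorb2)
qed

lemma continuous_on_seq_error:
  assumes "r \<ge> 1"
  shows "continuous_on (grid_seqs n b) (seq_error r n)"
  unfolding seq_error_def[abs_def] cell_def
  by (intro continuous_intros continuous_on_compose2[OF continuous_on_std_cell[OF assms]]
      continuous_on_subset[OF continuous_on_product_coordinates])
    (auto simp: grid_seqs_def)

lemma seq_error_attains_min:
  assumes "r \<ge> 1" "b \<ge> 0" "n > 0"
  obtains x where "x \<in> grid_seqs n b" "\<And>y. y \<in> grid_seqs n b \<Longrightarrow> seq_error r n x \<le> seq_error r n y"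
proof -
  \<comment> \<open>All points but the first sit at \<open>b\<close>; \<open>n > 0\<close> keeps
    this compatible with \<open>x 0 = 0\<close>.\<close>
  have "(\<lambda>i. if i = 0 then 0 else b) \<in> grid_seqs n b"
    using assms by (auto simp: grid_seqs_def)
  then have "grid_seqs n b \<noteq> {}" by auto
  from continuous_attains_inf[OF compact_grid_seqs this continuous_on_seq_error[OF assms(1)]]
  show thesis using that by auto
qed

text \<open>Moving a single point between its neighbours affects two cells only; the others, indexed
  by \<open>R\<close>, cancel in the comparison.\<close>

lemma minimizer_stationary:
  assumes r: "r \<ge> 1" and x: "x \<in> grid_seqs n b"
    and min: "\<And>y. y \<in> grid_seqs n b \<Longrightarrow> seq_error r n x \<le> seq_error r n y"
  shows "stationary r n x"
  unfolding stationary_def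
proof (intro allI impI)
  fix i assume i: "Suc i < n"
  have mono: "x i \<le> x (Suc i)" "x (Suc i) \<le> x (Suc (Suc i))"
    using x by (auto simp: grid_seqs_def)
  show "Phi_check r (x (Suc i) - x i) = Phi r (x (Suc (Suc i)) - x (Suc i))"
  proof (rule cell_split_minimum[OF r mono])
    fix y assume y: "x i \<le> y" "y \<le> x (Suc (Suc i))"
    define x' where "x' = x(Suc i := y)"
    have "x' \<in> grid_seqs n b"
      using x y i by (auto simp: grid_seqs_def x'_def)
    then have le: "seq_error r n x \<le> seq_error r n x'" by (rule min)
    define R where "R = {..<n} - {i, Suc i}"
    have split: "seq_error r n w = cell r (w i) (w (Suc i)) + cell r (w (Suc i)) (w (Suc (Suc i)))
        + (\<Sum>k\<in>R. cell r (w k) (w (Suc k)))" for w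
    proof -
      have "{..<n} = insert i (insert (Suc i) R)" using i by (auto simp: R_def)
      moreover have "finite R" "i \<notin> R" "Suc i \<notin> R" by (auto simp: R_def)
      ultimately show ?thesis by (simp add: seq_error_def)
    qed
    have "(\<Sum>k\<in>R. cell r (x' k) (x' (Suc k))) = (\<Sum>k\<in>R. cell r (x k) (x (Suc k)))"
      by (intro sum.cong) (auto simp: R_def x'_def)
    with le show "cell r (x i) (x (Suc i)) + cell r (x (Suc i)) (x (Suc (Suc i)))
        \<le> cell r (x i) y + cell r y (x (Suc (Suc i)))"
      unfolding split by (simp add: x'_def)
  qed
qed

text \<open>\<open>k\<close> counts gaps backwards from the last one, following the direction of
  \<open>theta_tilde\<close>.\<close>

lemma stationary_gap:
  assumes r: "r \<ge> 1" and x: "x \<in> grid_seqs n b" and st: "stationary r n x" and "k < n"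
  shows "x (n - k) - x (n - Suc k) = (theta_tilde r ^^ k) (x n - x (n - 1))"
  using \<open>k < n\<close>
proof (induction k)
  case (Suc k)
  define i where "i = n - Suc (Suc k)"
  have i: "n - Suc k = Suc i" "n - k = Suc (Suc i)" "Suc i < n"
    using Suc.prems by (auto simp: i_def)
  have "theta_tilde r (x (n - k) - x (n - Suc k)) = x (Suc i) - x i"
    using st x i r by (intro theta_tilde_eqI) (auto simp: stationary_def grid_seqs_def)
  then show ?case
    using Suc i(1) by (simp add: i_def)
qed simp

lemma grid_seqs_sum_gaps:
  assumes x: "x \<in> grid_seqs n b"
  shows "(\<Sum>k<n. x (Suc k) - x k) = b"
  using x by (simp add: sum_lessThan_telescope grid_seqs_def)

lemma stationary_sum:
  assumes r: "r \<ge> 1" and x: "x \<in> grid_seqs n b" and st: "stationary r n x"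
  shows "(\<Sum>k<n. (theta_tilde r ^^ k) (x n - x (n - 1))) = b"
proof -
  have "(\<Sum>k<n. (theta_tilde r ^^ k) (x n - x (n - 1))) = (\<Sum>k<n. x (n - k) - x (n - Suc k))"
    using stationary_gap[OF r x st] by simp
  also have "\<dots> = (\<Sum>k<n. x (Suc (n - Suc k)) - x (n - Suc k))"
    by (intro sum.cong) (auto simp: Suc_diff_Suc)
  also have "\<dots> = (\<Sum>k<n. x (Suc k) - x k)"
    by (rule sum.nat_diff_reindex[of "\<lambda>k. x (Suc k) - x k"])
  also have "\<dots> = b" using x by (rule grid_seqs_sum_gaps)
  finally show ?thesis .
qed

lemma grid_seqs_gap_eqI:
  assumes x: "x \<in> grid_seqs n b" and y: "y \<in> grid_seqs n b"
    and gap: "\<And>i. i < n \<Longrightarrow> x (Suc i) - x i = y (Suc i) - y i"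
  shows "x = y"
proof
  fix i
  have "x i = y i" if "i \<le> n"
    using that
  proof (induction i)
    case (Suc i)
    then show ?case using gap[of i] by simp
  qed (use x y in \<open>simp add: grid_seqs_def\<close>)
  moreover have "x i = y i" if "i \<ge> n"
    using that x y by (simp add: grid_seqs_def)
  ultimately show "x i = y i" by linarith
qed

text \<open>The sum of the iterates is injective in the last gap and equals \<open>b\<close> for
  both sequences; the common last gap then determines all the others.\<close>

lemma stationary_unique:
  assumes r: "r \<ge> 1" and n: "n > 0" and x: "x \<in> grid_seqs n b" "stationary r n x"
    and y: "y \<in> grid_seqs n b" "stationary r n y"
  shows "x = y"
proof (rule grid_seqs_gap_eqI[OF x(1) y(1)])
  have "x n - x (n - 1) = y n - y (n - 1)"
  proof (rule iterate_sum_inj[OF strict_mono_on_theta_tilde[OF r] theta_tilde_nonneg[OF r] n])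
    show "(\<Sum>k<n. (theta_tilde r ^^ k) (x n - x (n - 1))) = (\<Sum>k<n. (theta_tilde r ^^ k) (y n - y (n - 1)))"
      using stationary_sum[OF r x] stationary_sum[OF r y] by simp
  qed (use grid_seqs_mono[OF x(1), of "n - 1" n] grid_seqs_mono[OF y(1), of "n - 1" n] in auto)
  then show "x (Suc i) - x i = y (Suc i) - y i" if "i < n" for i
    using stationary_gap[OF r x, of "n - Suc i"] stationary_gap[OF r y, of "n - Suc i"] that
    by (simp add: Suc_diff_Suc)
qed

text \<open>A vanishing last gap would make all gaps vanish, since \<open>theta_tilde\<close> fixes
  0, contrary to \<open>b > 0\<close>. A positive one has positive iterates by strict
  monotonicity.\<close>

lemma stationary_gap_pos:
  assumes r: "r \<ge> 1" and b: "b > 0" and x: "x \<in> grid_seqs n b" "stationary r n x" and "i < n"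
  shows "x i < x (Suc i)"
proof -
  define d where "d = x n - x (n - 1)"
  have d0: "d \<ge> 0" using grid_seqs_mono[OF x(1), of "n - 1" n] by (simp add: d_def)
  have zero: "(theta_tilde r ^^ k) 0 = 0" for k
    by (induction k) (auto simp: theta_tilde_zero[OF r])
  have "d \<noteq> 0"
    using stationary_sum[OF r x] b zero by (auto simp: d_def)
  then have "(theta_tilde r ^^ (n - Suc i)) 0 < (theta_tilde r ^^ (n - Suc i)) d"
    using d0 r
    by (intro funpow_strict_mono_atLeast_0 strict_mono_on_theta_tilde theta_tilde_nonneg) auto
  then show ?thesis
    using stationary_gap[OF r x, of "n - Suc i"] \<open>i < n\<close> by (simp add: zero d_def Suc_diff_Suc)
qed

text \<open>A competitor with no larger error would itself be a minimizer, hence stationary, hence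
  equal to \<open>x\<close>.\<close>

lemma seq_error_unique_min:
  assumes r: "r \<ge> 1" and b: "b > 0" and n: "n > 0"
  obtains x where "x \<in> grid_seqs n b" "stationary r n x"
    "\<And>y. y \<in> grid_seqs n b \<Longrightarrow> y \<noteq> x \<Longrightarrow> seq_error r n x < seq_error r n y"
proof -
  obtain x where x: "x \<in> grid_seqs n b"
    and min: "\<And>y. y \<in> grid_seqs n b \<Longrightarrow> seq_error r n x \<le> seq_error r n y"
    using seq_error_attains_min[OF r _ n, of b] b by auto
  have st: "stationary r n x" by (rule minimizer_stationary[OF r x min])
  moreover have "seq_error r n x < seq_error r n y" if y: "y \<in> grid_seqs n b" "y \<noteq> x" for y
  proof (rule ccontr)
    assume "\<not> seq_error r n x < seq_error r n y"
    then have "stationary r n y"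
      using min by (intro minimizer_stationary[OF r y(1)]) (meson not_less order_trans)
    with stationary_unique[OF r n x st y(1)] y(2) show False by simp
  qed
  ultimately show thesis using x that by blast
qed

subsection \<open>Truncated exponential distributions\<close>

definition trunc_norm :: "real \<Rightarrow> real \<Rightarrow> real \<Rightarrow> real" where
  "trunc_norm l a b = (LINT y|lborel. indicator {a..b} y * exp (- l * (y - a)))"

lemma trunc_norm_pos:
  assumes "a < b"
  shows "trunc_norm l a b > 0"
proof -
  have cont: "continuous_on {a..b} (\<lambda>y. exp (- l * (y - a)))"
    by (intro continuous_intros)
  have "trunc_norm l a b = integral {a..b} (\<lambda>y. exp (- l * (y - a)))"
    using set_borel_integral_eq_integral(2)[OF borel_integrable_atLeastAtMost'[OF cont]]
    by (simp add: trunc_norm_def set_lebesgue_integral_def)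
  also have "\<dots> > integral {a..b} (\<lambda>y. 0)"
    using assms cont by (intro integral_less_real) auto
  finally show ?thesis by simp
qed

definition trunc_dens :: "real \<Rightarrow> real \<Rightarrow> real \<Rightarrow> real \<Rightarrow> real" where
  "trunc_dens l a b x = indicator {a..b} x * exp (- l * (x - a)) / trunc_norm l a b"

lemma trunc_exp_eq: "trunc_exp l a b = density lborel (\<lambda>x. ennreal (trunc_dens l a b x))"
  by (simp add: trunc_exp_def trunc_dens_def trunc_norm_def)

lemma trunc_dens_measurable [measurable]: "trunc_dens l a b \<in> borel_measurable borel"
  unfolding trunc_dens_def[abs_def] by measurable

lemma trunc_dens_nonneg: "a < b \<Longrightarrow> trunc_dens l a b x \<ge> 0"
  using trunc_norm_pos[of a b l] by (simp add: trunc_dens_def)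

lemma LINT_trunc_exp:
  assumes "a < b" and f: "f \<in> borel_measurable borel"
  shows "(LINT x|trunc_exp l a b. f x) = (LINT x|lborel. trunc_dens l a b x * f x)"
  unfolding trunc_exp_eq
  by (subst integral_density) (use assms trunc_dens_nonneg in auto)

lemma msupport_trunc_exp:
  assumes "a < b"
  shows "msupport (trunc_exp l a b) = {a..b}"
proof safe
  have em: "emeasure (trunc_exp l a b) U = (\<integral>\<^sup>+x. ennreal (trunc_dens l a b x) * indicator U x \<partial>lborel)"
    if "open U" for U
    unfolding trunc_exp_eq using that by (intro emeasure_density) auto
  fix x
  {
    assume x: "x \<in> msupport (trunc_exp l a b)"
    show "x \<in> {a..b}"
    proof (rule ccontr)
      assume "x \<notin> {a..b}"
      then have "x \<in> - {a..b}" "open (- {a..b})" by (auto intro: open_Compl)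
      then have "emeasure (trunc_exp l a b) (- {a..b}) > 0"
        using x unfolding msupport_def by blast
      moreover have "(\<integral>\<^sup>+x. ennreal (trunc_dens l a b x) * indicator (- {a..b}) x \<partial>lborel) = nn_integral lborel (\<lambda>_::real. 0)"
        by (intro nn_integral_cong) (auto simp: trunc_dens_def indicator_def)
      ultimately show False by (simp add: em open_Compl)
    qed
  }
  assume x: "x \<in> {a..b}"
  show "x \<in> msupport (trunc_exp l a b)"
    unfolding msupport_def
  proof safe
    fix U assume U: "open U" "x \<in> U"
    then obtain e where e: "e > 0" "ball x e \<subseteq> U" using open_contains_ball by blast
    \<comment> \<open>Cutting at \<open>a\<close> and \<open>b\<close> still leaves a nondegenerate
      interval when x is an endpoint of the support.\<close>
    define c d where "c = max a (x - e)" and "d = min b (x + e)"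
    have cd: "c < d" "{c<..<d} \<subseteq> U" "{c<..<d} \<subseteq> {a..b}"
      using x e assms by (auto simp: c_def d_def ball_def dist_real_def subset_iff)
    show "emeasure (trunc_exp l a b) U > 0"
    proof (rule ccontr)
      assume "\<not> 0 < emeasure (trunc_exp l a b) U"
      then have "(\<integral>\<^sup>+x. ennreal (trunc_dens l a b x) * indicator U x \<partial>lborel) = 0"
        using em[OF U(1)] by simp
      then have "AE x in lborel. ennreal (trunc_dens l a b x) * indicator U x = 0"
        using U(1) by (subst (asm) nn_integral_0_iff_AE) auto
      then have "AE x in lborel. x \<notin> {c<..<d}"
      proof eventually_elim
        case (elim x)
        have "trunc_dens l a b x > 0" if "x \<in> {c<..<d}"
          using that cd trunc_norm_pos[OF assms, of l] by (auto simp: trunc_dens_def)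
        with elim cd show ?case by (fastforce simp: indicator_def split: if_splits)
      qed
      then have "{c<..<d} \<in> null_sets lborel"
        by (subst AE_iff_null_sets) auto
      with cd(1) show False by (simp add: null_sets_def)
    qed
  qed
qed

lemma dq_grid_trunc_exp:
  assumes "a < b"
  shows "dq_grid N (trunc_exp l a b) \<Gamma> \<longleftrightarrow>
    finite \<Gamma> \<and> \<Gamma> \<noteq> {} \<and> card \<Gamma> \<le> N \<and> Min \<Gamma> \<le> a \<and> b \<le> Max \<Gamma>"
proof -
  have "convex hull {a..b} = {a..b}" by (simp add: hull_same)
  moreover have "{a..b} = {a'..b'} \<longleftrightarrow> a' = a \<and> b' = b" for a' b'
    using assms by (auto simp: Icc_eq_Icc)
  ultimately show ?thesis
    using assms unfolding dq_grid_def msupport_trunc_exp[OF assms] by auto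
qed

subsection \<open>The local error\<close>

definition local_err :: "real \<Rightarrow> real \<Rightarrow> real \<Rightarrow> real \<Rightarrow> real" where
  "local_err r u v \<xi> = (\<xi> - u) powr r * ((v - \<xi>) / (v - u)) + (v - \<xi>) powr r * ((\<xi> - u) / (v - u))"

lemma local_err_measurable [measurable]: "local_err r u v \<in> borel_measurable borel"
  unfolding local_err_def[abs_def] by measurable

lemma local_err_nonneg: "u < v \<Longrightarrow> u \<le> \<xi> \<Longrightarrow> \<xi> \<le> v \<Longrightarrow> local_err r u v \<xi> \<ge> 0"
  unfolding local_err_def by simp

lemma continuous_on_local_err:
  assumes "r \<ge> 1" "u < v"
  shows "continuous_on {u..v} (local_err r u v)"
  unfolding local_err_def[abs_def] using assms
  by (intro continuous_intros continuous_on_powr') auto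

text \<open>For \<open>u < \<xi> < v\<close> the local error is
  \<open>p q / (p + q) (p\<^sup>r\<^sup>-\<^sup>1 + q\<^sup>r\<^sup>-\<^sup>1)\<close> with \<open>p = \<xi> - u\<close> and \<open>q = v - \<xi>\<close>, which increases in \<open>p\<close> and \<open>q\<close>.\<close>

lemma local_err_mirror: "local_err r u v \<xi> = local_err r (- v) (- u) (- \<xi>)"
  by (simp add: local_err_def)

lemma local_err_strict_mono_right:
  assumes r: "r \<ge> 1" and "u < \<xi>" "\<xi> < v'" "v' < v"
  shows "local_err r u v' \<xi> < local_err r u v \<xi>"
proof -
  define p where "p = \<xi> - u"
  have p: "p > 0" using assms by (simp add: p_def)
  have eq: "local_err r u w \<xi> = p * ((w - \<xi>) / (p + (w - \<xi>)) * (p powr (r - 1) + (w - \<xi>) powr (r - 1)))"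
    if "w > \<xi>" for w
  proof -
    have eq: "p powr r = p * p powr (r - 1)" "(w - \<xi>) powr r = (w - \<xi>) * (w - \<xi>) powr (r - 1)"
      using powr_Suc_mult[of p "r - 1"] powr_Suc_mult[of "w - \<xi>" "r - 1"] p that by simp_all
    have "w - u = p + (w - \<xi>)" by (simp add: p_def)
    then show ?thesis
      unfolding local_err_def p_def[symmetric] by (simp only: eq) (simp add: distrib_left mult_ac)
  qed
  \<comment> \<open>Strictness comes from this factor; the sum of powers is merely nondecreasing,
    and constant at \<open>r = 1\<close>.\<close>
  have "(v' - \<xi>) / (p + (v' - \<xi>)) < (v - \<xi>) / (p + (v - \<xi>))"
    using assms p by (simp add: field_simps)
  moreover have "(v' - \<xi>) powr (r - 1) \<le> (v - \<xi>) powr (r - 1)"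
    using assms by (intro powr_mono2) auto
  ultimately have "(v' - \<xi>) / (p + (v' - \<xi>)) * (p powr (r - 1) + (v' - \<xi>) powr (r - 1))
      < (v - \<xi>) / (p + (v - \<xi>)) * (p powr (r - 1) + (v - \<xi>) powr (r - 1))"
    using assms p by (intro mult_less_le_imp_less) (auto simp: add_pos_nonneg)
  from mult_strict_left_mono[OF this p] show ?thesis
    using assms eq[of v] eq[of v'] by simp
qed

lemma local_err_strict_mono_left:
  assumes "r \<ge> 1" "u < u'" "u' < \<xi>" "\<xi> < v"
  shows "local_err r u' v \<xi> < local_err r u v \<xi>"
  using local_err_strict_mono_right[of r "- v" "- \<xi>" "- u'" "- u"] assms
  by (subst (1 2) local_err_mirror) simp

lemma local_err_mono:
  assumes "r \<ge> 1" "u \<le> u'" "u' < \<xi>" "\<xi> < v'" "v' \<le> v"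
  shows "local_err r u' v' \<xi> \<le> local_err r u v \<xi>"
    and "u < u' \<or> v' < v \<Longrightarrow> local_err r u' v' \<xi> < local_err r u v \<xi>"
proof -
  have "local_err r u' v' \<xi> \<le> local_err r u' v \<xi>" "v' < v \<Longrightarrow> local_err r u' v' \<xi> < local_err r u' v \<xi>"
    using local_err_strict_mono_right[of r u' \<xi> v' v] assms by (cases "v' = v"; auto)+
  moreover have "local_err r u' v \<xi> \<le> local_err r u v \<xi>" "u < u' \<Longrightarrow> local_err r u' v \<xi> < local_err r u v \<xi>"
    using local_err_strict_mono_left[of r u u' \<xi> v] assms by (cases "u' = u"; auto)+
  ultimately show "local_err r u' v' \<xi> \<le> local_err r u v \<xi>"
    "u < u' \<or> v' < v \<Longrightarrow> local_err r u' v' \<xi> < local_err r u v \<xi>" by auto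
qed

subsection \<open>Cell errors of the standard truncated exponential distribution\<close>

text \<open>In contrast to \<open>cell\<close>, the cell may overshoot the support
  \<open>{0..b}\<close>: its true endpoints enter the local error, but only its part inside carries
  mass.\<close>

definition cell_err :: "real \<Rightarrow> real \<Rightarrow> real \<Rightarrow> real \<Rightarrow> real" where
  "cell_err r b u v = integral {max u 0..min v b} (\<lambda>\<xi>. local_err r u v \<xi> * exp (- \<xi>))"

lemma continuous_on_local_err_exp:
  assumes "r \<ge> 1" "u < v"
  shows "continuous_on {max u 0..min v b} (\<lambda>\<xi>. local_err r u v \<xi> * exp (- \<xi>))"
  by (intro continuous_intros continuous_on_subset[OF continuous_on_local_err[OF assms]]) auto

lemma LINT_cell_trunc_exp:
  assumes r: "r \<ge> 1" and b: "b > 0" and uv: "u < v"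
  shows "(LINT \<xi>:{u..<v}|trunc_exp 1 0 b. local_err r u v \<xi>) = cell_err r b u v / trunc_norm 1 0 b"
proof -
  have "(LINT \<xi>:{u..<v}|trunc_exp 1 0 b. local_err r u v \<xi>)
      = (LINT \<xi>|lborel. trunc_dens 1 0 b \<xi> * (indicator {u..<v} \<xi> *\<^sub>R local_err r u v \<xi>))"
    unfolding set_lebesgue_integral_def using b by (intro LINT_trunc_exp) auto
  \<comment> \<open>The half-open cell and the closed interval differ at most in the null set
    \<open>{v}\<close>.\<close>
  also have "\<dots> = (LINT \<xi>|lborel. indicator {max u 0..min v b} \<xi> *\<^sub>R (local_err r u v \<xi> * exp (- \<xi>)) / trunc_norm 1 0 b)"
    using AE_lborel_singleton[of v]
    by (intro integral_cong_AE) (auto simp: trunc_dens_def indicator_def elim!: eventually_mono)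
  also have "\<dots> = (LINT \<xi>:{max u 0..min v b}|lborel. local_err r u v \<xi> * exp (- \<xi>)) / trunc_norm 1 0 b"
    by (simp add: set_lebesgue_integral_def)
  also have "\<dots> = cell_err r b u v / trunc_norm 1 0 b"
    unfolding cell_err_def
    using set_borel_integral_eq_integral(2)[OF borel_integrable_atLeastAtMost'[OF
        continuous_on_local_err_exp[OF r uv, of b]]] by simp
  finally show ?thesis .
qed

lemma cell_eq_integral:
  assumes r: "r \<ge> 1" and uv: "u \<le> v"
  shows "cell r u v = integral {u..v} (\<lambda>\<xi>. local_err r u v \<xi> * exp (- \<xi>))"
proof -
  define x where "x = v - u"
  let ?f = "\<lambda>s. (s powr r * (x - s) + (x - s) powr r * s) / x * exp (- s)"
  have "(?f has_integral std_cell r x) (cbox 0 x)"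
    using std_cell_has_integral[of r x] r by simp
  from has_integral_affinity[OF this, of 1 "- u"]
  have "((\<lambda>\<xi>. ?f (\<xi> - u)) has_integral std_cell r x) {u..v}"
    using image_affinity_cbox[of 1 u 0 x] uv by (simp add: x_def add.commute)
  from has_integral_mult_right[OF this, of "exp (- u)"]
  have "((\<lambda>\<xi>. exp (- u) * ?f (\<xi> - u)) has_integral cell r u v) {u..v}"
    by (simp add: cell_def x_def)
  moreover have "exp (- u) * ?f (\<xi> - u) = local_err r u v \<xi> * exp (- \<xi>)" for \<xi>
  proof -
    have "exp (- u) * exp (- (\<xi> - u)) = exp (- \<xi>)" by (simp flip: exp_add)
    then have "exp (- u) * ?f (\<xi> - u)
        = (((\<xi> - u) powr r * (v - \<xi>) + (v - \<xi>) powr r * (\<xi> - u)) / x) * exp (- \<xi>)"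
      by (simp add: x_def)
    then show ?thesis by (simp add: local_err_def x_def add_divide_distrib)
  qed
  ultimately show ?thesis by (simp add: integral_unique)
qed

definition clip :: "real \<Rightarrow> real \<Rightarrow> real" where
  "clip b x = max 0 (min b x)"

lemma cell_refl [simp]: "cell r u u = 0"
  by (simp add: cell_def)

text \<open>Clipping leaves the domain of integration unchanged and lowers the integrand pointwise,
  strictly if an endpoint moves. If the clipped cell collapses, a zero is compared with a
  nonnegative integral.\<close>

lemma cell_clip_le_cell_err:
  assumes r: "r \<ge> 1" and b: "b > 0" and uv: "u < v"
  shows "cell r (clip b u) (clip b v) \<le> cell_err r b u v"
    and "clip b u < clip b v \<Longrightarrow> u < 0 \<or> b < v \<Longrightarrow> cell r (clip b u) (clip b v) < cell_err r b u v"
    and "0 \<le> u \<Longrightarrow> v \<le> b \<Longrightarrow> cell_err r b u v = cell r u v"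
proof -
  define u' v' where "u' = max u 0" and "v' = min v b"
  have clip_eq: "clip b u = u'" "clip b v = v'" "u' < v'" if "clip b u < clip b v"
    using that b uv by (auto simp: clip_def u'_def v'_def max_def min_def split: if_splits)
  have lt: "cell r (clip b u) (clip b v) < cell_err r b u v"
    if "clip b u < clip b v" "u < 0 \<or> b < v"
  proof -
    note clip_eq = clip_eq[OF that(1)]
    have le: "u \<le> u'" "v' \<le> v" by (auto simp: u'_def v'_def)
    have "cell r u' v' = integral {u'..v'} (\<lambda>\<xi>. local_err r u' v' \<xi> * exp (- \<xi>))"
      using cell_eq_integral[OF r] clip_eq by simp
    also have "\<dots> < integral {u'..v'} (\<lambda>\<xi>. local_err r u v \<xi> * exp (- \<xi>))"
    proof (rule integral_less_real)
      show "continuous_on {u'..v'} (\<lambda>\<xi>. local_err r u' v' \<xi> * exp (- \<xi>))"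
        using clip_eq by (intro continuous_intros continuous_on_local_err r)
      show "continuous_on {u'..v'} (\<lambda>\<xi>. local_err r u v \<xi> * exp (- \<xi>))"
        unfolding u'_def v'_def by (rule continuous_on_local_err_exp[OF r uv])
      fix \<xi> assume "\<xi> \<in> {u'<..<v'}"
      moreover have "u < u' \<or> v' < v" using that(2) by (auto simp: u'_def v'_def)
      ultimately show "local_err r u' v' \<xi> * exp (- \<xi>) < local_err r u v \<xi> * exp (- \<xi>)"
        using local_err_mono(2)[OF r le(1) _ _ le(2), of \<xi>] by simp
    qed (use clip_eq in auto)
    finally show ?thesis by (simp add: clip_eq cell_err_def u'_def v'_def)
  qed
  then show "clip b u < clip b v \<Longrightarrow> u < 0 \<or> b < v \<Longrightarrow> cell r (clip b u) (clip b v) < cell_err r b u v" .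
  show eq: "0 \<le> u \<Longrightarrow> v \<le> b \<Longrightarrow> cell_err r b u v = cell r u v"
    using uv cell_eq_integral[OF r, of u v] by (simp add: cell_err_def max_absorb1 min_absorb1)
  show "cell r (clip b u) (clip b v) \<le> cell_err r b u v"
  proof (cases "clip b u < clip b v")
    case True
    show ?thesis
    proof (cases "u < 0 \<or> b < v")
      case False
      then have "clip b u = u" "clip b v = v" using uv by (auto simp: clip_def)
      with False show ?thesis using eq by simp
    qed (use lt True in simp)
  next
    case False
    then have "clip b u = clip b v" using uv by (auto simp: clip_def)
    moreover have "cell_err r b u v \<ge> 0"
      unfolding cell_err_def using uv
      by (intro integral_nonneg integrable_continuous_real continuous_on_local_err_exp r uv)
        (auto intro!: mult_nonneg_nonneg local_err_nonneg)
    ultimately show ?thesis by simp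
  qed
qed

subsection \<open>Grids and sequences\<close>

lemma sorted_list_of_set_eqI:
  fixes xs :: "real list"
  assumes "sorted_wrt (<) xs"
  shows "sorted_list_of_set (set xs) = xs"
  by (metis List.finite_set assms set_sorted_list_of_set strict_sorted_equal strict_sorted_list_of_set)

lemma dq_error_trunc_exp:
  assumes r: "r \<ge> 1" and b: "b > 0" and xs: "xs = sorted_list_of_set \<Gamma>"
  shows "dq_error r (trunc_exp 1 0 b) \<Gamma>
    = (\<Sum>i<card \<Gamma> - 1. cell_err r b (xs ! i) (xs ! Suc i)) / trunc_norm 1 0 b"
proof -
  have "xs ! i < xs ! Suc i" if "i < card \<Gamma> - 1" for i
    using that sorted_wrt_nth_less[OF strict_sorted_list_of_set, of i "Suc i" \<Gamma>] by (simp add: xs)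
  then have "(LINT \<xi>:{xs ! i..<xs ! Suc i}|trunc_exp 1 0 b. local_err r (xs ! i) (xs ! Suc i) \<xi>)
      = cell_err r b (xs ! i) (xs ! Suc i) / trunc_norm 1 0 b" if "i < card \<Gamma> - 1" for i
    using LINT_cell_trunc_exp[OF r b] that by blast
  then show ?thesis
    by (simp add: dq_error_def Let_def local_err_def sum_divide_distrib flip: xs)
qed

text \<open>Clipping may merge points and a small grid is padded with \<open>b\<close>;
  \<open>grid_seqs\<close> admits both kinds of repetition.\<close>

definition grid_seq :: "real \<Rightarrow> real set \<Rightarrow> nat \<Rightarrow> real" where
  "grid_seq b \<Gamma> i = (if i < card \<Gamma> then clip b (sorted_list_of_set \<Gamma> ! i) else b)"

context
  fixes r b :: real and n :: nat and \<Gamma> :: "real set" and xs :: "real list"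
  assumes r: "r \<ge> 1" and b: "b > 0"
    and \<Gamma>: "finite \<Gamma>" "\<Gamma> \<noteq> {}" "card \<Gamma> \<le> Suc n" "Min \<Gamma> \<le> 0" "b \<le> Max \<Gamma>"
    and xs: "xs = sorted_list_of_set \<Gamma>"
begin

lemma grid_nth_less: "i < j \<Longrightarrow> j < card \<Gamma> \<Longrightarrow> xs ! i < xs ! j"
  using sorted_wrt_nth_less[OF strict_sorted_list_of_set, of i j \<Gamma>] by (simp add: xs)

lemma grid_set: "set xs = \<Gamma>" "length xs = card \<Gamma>"
  using \<Gamma>(1) by (simp_all add: xs)

lemma grid_card_pos: "card \<Gamma> > 0"
  using \<Gamma> by (simp add: card_gt_0_iff)

lemma grid_ends: "xs ! 0 \<le> 0" "b \<le> xs ! (card \<Gamma> - 1)"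
proof -
  have "Min \<Gamma> \<in> set xs" "Max \<Gamma> \<in> set xs" using \<Gamma> grid_set by auto
  then obtain i j where ij: "i < card \<Gamma>" "xs ! i = Min \<Gamma>" "j < card \<Gamma>" "xs ! j = Max \<Gamma>"
    by (metis grid_set(2) in_set_conv_nth)
  have "xs ! 0 \<le> xs ! i" using grid_nth_less[of 0 i] ij by (cases "i = 0") auto
  moreover have "xs ! j \<le> xs ! (card \<Gamma> - 1)"
  proof -
    have "j = card \<Gamma> - 1 \<or> j < card \<Gamma> - 1" using ij by linarith
    then show ?thesis using grid_nth_less[of j "card \<Gamma> - 1"] ij by auto
  qed
  ultimately show "xs ! 0 \<le> 0" "b \<le> xs ! (card \<Gamma> - 1)" using ij \<Gamma>(4,5) by linarith+
qed

text \<open>The index \<open>card \<Gamma> - 1\<close> already counts, because the largest grid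
  point is at least \<open>b\<close> and is clipped to \<open>b\<close>.\<close>

lemma grid_seq_last: "i \<ge> card \<Gamma> - 1 \<Longrightarrow> grid_seq b \<Gamma> i = b"
  using grid_ends b grid_card_pos
  by (cases "i = card \<Gamma> - 1") (auto simp: grid_seq_def clip_def simp flip: xs)

lemma grid_seq_in_grid_seqs: "grid_seq b \<Gamma> \<in> grid_seqs n b"
  unfolding grid_seqs_def
proof safe
  show "grid_seq b \<Gamma> 0 = 0"
    using grid_ends b grid_card_pos by (simp add: grid_seq_def clip_def flip: xs)
  fix i
  show "grid_seq b \<Gamma> i \<le> grid_seq b \<Gamma> (Suc i)"
    using grid_nth_less[of i "Suc i"] b by (auto simp: grid_seq_def clip_def simp flip: xs)
  show "grid_seq b \<Gamma> i = b" if "n \<le> i"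
    using that \<Gamma> by (intro grid_seq_last) auto
qed

lemma seq_error_grid_seq:
  "seq_error r n (grid_seq b \<Gamma>) = (\<Sum>i<card \<Gamma> - 1. cell r (clip b (xs ! i)) (clip b (xs ! Suc i)))"
proof -
  have "seq_error r n (grid_seq b \<Gamma>)
      = (\<Sum>i<card \<Gamma> - 1. cell r (grid_seq b \<Gamma> i) (grid_seq b \<Gamma> (Suc i)))"
    \<comment> \<open>The padded cells have both ends at \<open>b\<close> and contribute 0.\<close>
    unfolding seq_error_def
    using \<Gamma>(3) by (intro sum.mono_neutral_right) (auto simp: grid_seq_last)
  also have "\<dots> = (\<Sum>i<card \<Gamma> - 1. cell r (clip b (xs ! i)) (clip b (xs ! Suc i)))"
    by (intro sum.cong) (auto simp: grid_seq_def simp flip: xs)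
  finally show ?thesis .
qed

lemma seq_error_le_dq_error:
  "seq_error r n (grid_seq b \<Gamma>) \<le> dq_error r (trunc_exp 1 0 b) \<Gamma> * trunc_norm 1 0 b"
proof -
  have "seq_error r n (grid_seq b \<Gamma>) \<le> (\<Sum>i<card \<Gamma> - 1. cell_err r b (xs ! i) (xs ! Suc i))"
    unfolding seq_error_grid_seq
    by (intro sum_mono cell_clip_le_cell_err r b grid_nth_less) auto
  then show ?thesis
    using trunc_norm_pos[OF b, of 1] by (simp add: dq_error_trunc_exp[OF r b xs])
qed

text \<open>Excludes overshooting: an end cell that leaves the support loses error strictly when
  clipped, as \<open>inc\<close> keeps the clipped cell nondegenerate.\<close>

lemma seq_error_less_dq_error:
  assumes n: "card \<Gamma> = Suc n" "n > 0" and inc: "\<And>i. i < n \<Longrightarrow> grid_seq b \<Gamma> i < grid_seq b \<Gamma> (Suc i)"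
    and out: "xs ! 0 < 0 \<or> b < xs ! n"
  shows "seq_error r n (grid_seq b \<Gamma>) < dq_error r (trunc_exp 1 0 b) \<Gamma> * trunc_norm 1 0 b"
proof -
  have clip_less: "clip b (xs ! i) < clip b (xs ! Suc i)" if "i < n" for i
    using inc[OF that] that n by (simp add: grid_seq_def flip: xs)
  have "seq_error r n (grid_seq b \<Gamma>) < (\<Sum>i<card \<Gamma> - 1. cell_err r b (xs ! i) (xs ! Suc i))"
    unfolding seq_error_grid_seq
  proof (rule sum_strict_mono_ex1)
    show "\<forall>i\<in>{..<card \<Gamma> - 1}. cell r (clip b (xs ! i)) (clip b (xs ! Suc i)) \<le> cell_err r b (xs ! i) (xs ! Suc i)"
      by (intro ballI cell_clip_le_cell_err r b grid_nth_less) auto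
    \<comment> \<open>The first cell if the grid overshoots on the left, otherwise the last.\<close>
    define i where "i = (if xs ! 0 < 0 then 0 else n - 1)"
    have "i \<in> {..<card \<Gamma> - 1}" using n by (auto simp: i_def)
    moreover have "cell r (clip b (xs ! i)) (clip b (xs ! Suc i)) < cell_err r b (xs ! i) (xs ! Suc i)"
      using n out by (intro cell_clip_le_cell_err r b grid_nth_less clip_less) (auto simp: i_def)
    ultimately show "\<exists>i\<in>{..<card \<Gamma> - 1}. cell r (clip b (xs ! i)) (clip b (xs ! Suc i))
        < cell_err r b (xs ! i) (xs ! Suc i)" by blast
  qed auto
  then show ?thesis
    using trunc_norm_pos[OF b, of 1] by (simp add: dq_error_trunc_exp[OF r b xs])
qed

end

text \<open>The error of the minimizing sequence bounds that of the clipped sequence of any grid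
  from below, and the latter bounds the unnormalised grid error. \<open>X\<close> attains the lower
  bound; for any optimal grid both inequalities become equalities, which force it to be
  \<open>X\<close>.\<close>

lemma dq_optimal_standard:
  assumes r: "r \<ge> 1" and b: "b > 0" and n: "n > 0"
  obtains x where "x \<in> grid_seqs n b" "stationary r n x"
    "\<And>\<Gamma>. dq_optimal r (Suc n) (trunc_exp 1 0 b) \<Gamma> \<longleftrightarrow> \<Gamma> = set (map x [0..<Suc n])"
    "sorted_wrt (<) (map x [0..<Suc n])"
proof -
  obtain x where x: "x \<in> grid_seqs n b" "stationary r n x"
    and min: "\<And>y. y \<in> grid_seqs n b \<Longrightarrow> y \<noteq> x \<Longrightarrow> seq_error r n x < seq_error r n y"
    using seq_error_unique_min[OF r b n] by blast
  let ?\<mu> = "trunc_exp 1 0 b"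
  have Z: "trunc_norm 1 0 b > 0" using b by (rule trunc_norm_pos)
  have inc: "x i < x (Suc i)" if "i < n" for i
    using stationary_gap_pos[OF r b x that] .
  have less: "x i < x j" if "i < j" "j \<le> n" for i j
    using that
  proof (induction j)
    case (Suc j)
    then show ?case using inc[of j] by (cases "i = j") auto
  qed simp
  have sorted: "sorted_wrt (<) (map x [0..<Suc n])"
    using less by (auto simp: sorted_wrt_iff_nth_less simp del: upt_Suc)
  define X where "X = set (map x [0..<Suc n])"
  have list_X: "sorted_list_of_set X = map x [0..<Suc n]"
    unfolding X_def using sorted by (rule sorted_list_of_set_eqI)
  have card_X: "card X = Suc n"
    using arg_cong[OF list_X, of length] by (simp del: upt_Suc)
  have x0: "x 0 = 0" "x n = b" using x(1) by (auto simp: grid_seqs_def)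
  have fin_X: "finite X" "X \<noteq> {}" by (auto simp: X_def)
  have "x 0 \<in> X" "x n \<in> X" by (auto simp: X_def simp del: upt_Suc)
  then have grid_X: "dq_grid (Suc n) ?\<mu> X"
    using Min_le[OF fin_X(1)] Max_ge[OF fin_X(1)] x0 card_X fin_X
    by (simp add: dq_grid_trunc_exp[OF b])
  have err_X: "dq_error r ?\<mu> X * trunc_norm 1 0 b = seq_error r n x"
  proof -
    have "cell_err r b (x i) (x (Suc i)) = cell r (x i) (x (Suc i))" if "i < n" for i
      using inc[OF that] grid_seqs_bounds[OF x(1)]
      by (intro cell_clip_le_cell_err(3) r b) auto
    then have "(\<Sum>i<n. cell_err r b (x i) (x (Suc i))) = seq_error r n x"
      unfolding seq_error_def by simp
    moreover have "dq_error r ?\<mu> X = (\<Sum>i<n. cell_err r b (x i) (x (Suc i))) / trunc_norm 1 0 b"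
      unfolding dq_error_trunc_exp[OF r b refl] list_X card_X
      by (simp add: nth_append del: upt_Suc)
    ultimately show ?thesis using Z by simp
  qed
  have lower: "seq_error r n x \<le> seq_error r n (grid_seq b \<Gamma>)"
      "seq_error r n (grid_seq b \<Gamma>) \<le> dq_error r ?\<mu> \<Gamma> * trunc_norm 1 0 b"
      "seq_error r n x = seq_error r n (grid_seq b \<Gamma>) \<Longrightarrow> grid_seq b \<Gamma> = x"
    if "dq_grid (Suc n) ?\<mu> \<Gamma>" for \<Gamma>
  proof -
    have \<Gamma>: "finite \<Gamma>" "\<Gamma> \<noteq> {}" "card \<Gamma> \<le> Suc n" "Min \<Gamma> \<le> 0" "b \<le> Max \<Gamma>"
      using that by (simp_all add: dq_grid_trunc_exp[OF b])
    note gs = grid_seq_in_grid_seqs[OF r b \<Gamma> refl]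
    show "seq_error r n x \<le> seq_error r n (grid_seq b \<Gamma>)"
      using min[OF gs] by (cases "grid_seq b \<Gamma> = x") auto
    show "seq_error r n x = seq_error r n (grid_seq b \<Gamma>) \<Longrightarrow> grid_seq b \<Gamma> = x"
      using min[OF gs] by auto
    show "seq_error r n (grid_seq b \<Gamma>) \<le> dq_error r ?\<mu> \<Gamma> * trunc_norm 1 0 b"
      by (rule seq_error_le_dq_error[OF r b \<Gamma> refl])
  qed
  have "dq_optimal r (Suc n) ?\<mu> X"
    unfolding dq_optimal_def
  proof (intro conjI allI impI grid_X)
    fix \<Gamma> assume "dq_grid (Suc n) ?\<mu> \<Gamma>"
    from lower(1,2)[OF this] have "dq_error r ?\<mu> X * trunc_norm 1 0 b \<le> dq_error r ?\<mu> \<Gamma> * trunc_norm 1 0 b"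
      using err_X by simp
    then show "dq_error r ?\<mu> X \<le> dq_error r ?\<mu> \<Gamma>" using Z by simp
  qed
  moreover have "\<Gamma> = X" if opt: "dq_optimal r (Suc n) ?\<mu> \<Gamma>" for \<Gamma>
  proof -
    have grid: "dq_grid (Suc n) ?\<mu> \<Gamma>" using opt by (simp add: dq_optimal_def)
    then have \<Gamma>: "finite \<Gamma>" "\<Gamma> \<noteq> {}" "card \<Gamma> \<le> Suc n" "Min \<Gamma> \<le> 0" "b \<le> Max \<Gamma>"
      by (simp_all add: dq_grid_trunc_exp[OF b])
    define xs where "xs = sorted_list_of_set \<Gamma>"
    note ctx = r b \<Gamma> xs_def
    have "dq_error r ?\<mu> \<Gamma> \<le> dq_error r ?\<mu> X" using opt grid_X by (simp add: dq_optimal_def)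
    then have "dq_error r ?\<mu> \<Gamma> * trunc_norm 1 0 b \<le> seq_error r n x"
      using Z by (simp flip: err_X)
    with lower(1,2)[OF grid]
    have err_eq: "seq_error r n x = seq_error r n (grid_seq b \<Gamma>)"
        "dq_error r ?\<mu> \<Gamma> * trunc_norm 1 0 b = seq_error r n (grid_seq b \<Gamma>)" by simp_all
    from lower(3)[OF grid err_eq(1)] have gs: "grid_seq b \<Gamma> = x" .
    \<comment> \<open>With fewer points the padded sequence would reach \<open>b\<close> before
      index \<open>n\<close>, where \<open>x\<close> is still strictly below
      \<open>b\<close>.\<close>
    have card: "card \<Gamma> = Suc n"
    proof (rule ccontr)
      assume "card \<Gamma> \<noteq> Suc n"
      then have "card \<Gamma> - 1 < n" using \<Gamma>(3) n by simp
      then have "x (card \<Gamma> - 1) < x n" by (intro less) auto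
      with grid_seq_last[OF ctx, of "card \<Gamma> - 1"] gs x0 show False by simp
    qed
    have inc': "grid_seq b \<Gamma> i < grid_seq b \<Gamma> (Suc i)" if "i < n" for i
      using inc[OF that] gs by simp
    \<comment> \<open>All points therefore lie in the support, clipping is the identity, and the
      grid itself can be recovered from \<open>grid_seq\<close>.\<close>
    have "\<not> (xs ! 0 < 0 \<or> b < xs ! n)"
      using seq_error_less_dq_error[OF ctx card n inc'] err_eq(2) by auto
    moreover have "xs ! 0 \<le> xs ! i" "xs ! i \<le> xs ! n" if "i \<le> n" for i
      using that grid_nth_less[OF ctx, of 0 i] grid_nth_less[OF ctx, of i n] card
      by (cases "i = 0"; cases "i = n"; simp add: less_imp_le)+
    ultimately have "0 \<le> xs ! i" "xs ! i \<le> b" if "i \<le> n" for i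
      using that by (meson linorder_not_less order_trans)+
    then have "clip b (xs ! i) = xs ! i" if "i \<le> n" for i
      using that by (simp add: clip_def)
    then have "xs ! i = x i" if "i \<le> n" for i
      using that gs[symmetric] card by (simp add: grid_seq_def flip: xs_def)
    moreover have "length xs = Suc n" using grid_set(2)[OF ctx] card by simp
    ultimately have "xs = map x [0..<Suc n]"
      by (intro nth_equalityI) (auto simp del: upt_Suc)
    then show "\<Gamma> = X" using grid_set(1)[OF ctx] by (simp add: X_def del: upt_Suc)
  qed
  ultimately have "dq_optimal r (Suc n) ?\<mu> \<Gamma> \<longleftrightarrow> \<Gamma> = X" for \<Gamma> by blast
  then show thesis using that[OF x _ sorted] unfolding X_def by blast
qed

subsection \<open>Affine change of variables\<close>

lemma local_err_affine:
  assumes "l > 0" "u \<le> \<xi>" "\<xi> \<le> v"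
  shows "local_err r (l * (u - a)) (l * (v - a)) (l * (\<xi> - a)) = l powr r * local_err r u v \<xi>"
proof -
  have "l * (\<xi> - a) - l * (u - a) = l * (\<xi> - u)" "l * (v - a) - l * (\<xi> - a) = l * (v - \<xi>)"
    "l * (v - a) - l * (u - a) = l * (v - u)" by (simp_all add: algebra_simps)
  then show ?thesis
    unfolding local_err_def using assms by (simp add: powr_mult distrib_left)
qed

lemma trunc_norm_affine:
  assumes "l > 0"
  shows "trunc_norm 1 0 (l * (b - a)) = l * trunc_norm l a b"
proof -
  have "trunc_norm 1 0 (l * (b - a))
      = \<bar>l\<bar> *\<^sub>R (LINT x|lborel. indicator {0..l * (b - a)} (- l * a + l * x) * exp (- 1 * ((- l * a + l * x) - 0)))"
    unfolding trunc_norm_def using assms by (intro lborel_integral_real_affine) auto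
  also have "(\<lambda>x. indicator {0..l * (b - a)} (- l * a + l * x) * exp (- 1 * ((- l * a + l * x) - 0)))
      = (\<lambda>x. indicator {a..b} x * exp (- l * (x - a)) :: real)"
  proof
    fix x
    have "- l * a + l * x = l * (x - a)" by (simp add: algebra_simps)
    then show "indicator {0..l * (b - a)} (- l * a + l * x) * exp (- 1 * ((- l * a + l * x) - 0))
        = (indicator {a..b} x * exp (- l * (x - a)) :: real)"
      using assms by (simp add: indicator_def zero_le_mult_iff)
  qed
  finally show ?thesis using assms by (simp add: trunc_norm_def)
qed

text \<open>The Jacobian \<open>l\<close> cancels against the factor \<open>l\<close> between the
  normalizing constants; only the homogeneity factor \<open>l powr r\<close> of the local error
  remains.\<close>

lemma LINT_local_err_affine:
  assumes l: "l > 0" and ab: "a < b"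
  shows "(LINT \<xi>:{l * (u - a)..<l * (v - a)}|trunc_exp 1 0 (l * (b - a)). local_err r (l * (u - a)) (l * (v - a)) \<xi>)
    = l powr r * (LINT \<xi>:{u..<v}|trunc_exp l a b. local_err r u v \<xi>)"
proof -
  define f where "f = (\<lambda>\<xi>. trunc_dens 1 0 (l * (b - a)) \<xi> *
    (indicator {l * (u - a)..<l * (v - a)} \<xi> *\<^sub>R local_err r (l * (u - a)) (l * (v - a)) \<xi>))"
  have "(LINT \<xi>:{l * (u - a)..<l * (v - a)}|trunc_exp 1 0 (l * (b - a)). local_err r (l * (u - a)) (l * (v - a)) \<xi>)
      = (LINT \<xi>|lborel. f \<xi>)"
    unfolding set_lebesgue_integral_def f_def using assms by (intro LINT_trunc_exp) auto
  also have "\<dots> = \<bar>l\<bar> *\<^sub>R (LINT x|lborel. f (- l * a + l * x))"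
    using l by (intro lborel_integral_real_affine) auto
  also have "\<dots> = (LINT x|lborel. l powr r * (trunc_dens l a b x * (indicator {u..<v} x *\<^sub>R local_err r u v x)))"
  proof -
    have "l * f (- l * a + l * x) = l powr r * (trunc_dens l a b x * (indicator {u..<v} x *\<^sub>R local_err r u v x))" for x
    proof -
      have eq: "- l * a + l * x = l * (x - a)" by (simp add: algebra_simps)
      have "indicator {0..l * (b - a)} (l * (x - a)) = (indicator {a..b} x :: real)"
        "indicator {l * (u - a)..<l * (v - a)} (l * (x - a)) = (indicator {u..<v} x :: real)"
        using l by (simp_all add: indicator_def zero_le_mult_iff)
      then have "l * f (- l * a + l * x) = trunc_dens l a b x *
          (indicator {u..<v} x * local_err r (l * (u - a)) (l * (v - a)) (l * (x - a)))"
        unfolding f_def eq trunc_dens_def trunc_norm_affine[OF l] using l by simp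
      also have "\<dots> = l powr r * (trunc_dens l a b x * (indicator {u..<v} x *\<^sub>R local_err r u v x))"
        using local_err_affine[OF l, of u x v r a] by (simp add: indicator_def)
      finally show ?thesis .
    qed
    then show ?thesis using l by (simp flip: integral_mult_right_zero)
  qed
  also have "\<dots> = l powr r * (LINT x|lborel. trunc_dens l a b x * (indicator {u..<v} x *\<^sub>R local_err r u v x))"
    by simp
  also have "\<dots> = l powr r * (LINT \<xi>:{u..<v}|trunc_exp l a b. local_err r u v \<xi>)"
    unfolding set_lebesgue_integral_def using ab by (subst LINT_trunc_exp) auto
  finally show ?thesis .
qed

context
  fixes l a b :: real and L :: "real \<Rightarrow> real"
  assumes l: "l > 0" and ab: "a < b"
  defines "L \<equiv> \<lambda>x. l * (x - a)"
begin

lemma strict_mono_affine: "strict_mono L"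
  using l by (auto simp: L_def strict_mono_def)

lemma sorted_list_of_set_affine:
  assumes "finite \<Gamma>"
  shows "sorted_list_of_set (L ` \<Gamma>) = map L (sorted_list_of_set \<Gamma>)"
proof -
  have "sorted_wrt (<) (map L (sorted_list_of_set \<Gamma>))"
    unfolding sorted_wrt_map using strict_sorted_list_of_set[of \<Gamma>]
    by (rule sorted_wrt_mono_rel[rotated]) (rule strict_monoD[OF strict_mono_affine])
  from sorted_list_of_set_eqI[OF this] show ?thesis using assms by simp
qed

lemma card_affine: "card (L ` \<Gamma>) = card \<Gamma>"
  using strict_mono_affine by (intro card_image strict_mono_imp_inj_on)

lemma dq_error_affine:
  assumes "finite \<Gamma>"
  shows "dq_error r (trunc_exp 1 0 (l * (b - a))) (L ` \<Gamma>) = l powr r * dq_error r (trunc_exp l a b) \<Gamma>"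
proof -
  define xs where "xs = sorted_list_of_set \<Gamma>"
  have len: "length xs = card \<Gamma>" using assms by (simp add: xs_def)
  have "dq_error r (trunc_exp 1 0 (l * (b - a))) (L ` \<Gamma>)
    = (\<Sum>i<card \<Gamma> - 1. LINT \<xi>:{L (xs ! i)..<L (xs ! Suc i)}|trunc_exp 1 0 (l * (b - a)).
        local_err r (L (xs ! i)) (L (xs ! Suc i)) \<xi>)"
    unfolding dq_error_def Let_def card_affine sorted_list_of_set_affine[OF assms] local_err_def
    using len by (intro sum.cong) (auto simp: xs_def[symmetric])
  also have "\<dots> = (\<Sum>i<card \<Gamma> - 1. l powr r *
      (LINT \<xi>:{xs ! i..<xs ! Suc i}|trunc_exp l a b. local_err r (xs ! i) (xs ! Suc i) \<xi>))"
    unfolding L_def LINT_local_err_affine[OF l ab] ..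
  also have "\<dots> = l powr r * dq_error r (trunc_exp l a b) \<Gamma>"
    unfolding dq_error_def Let_def local_err_def xs_def by (simp add: sum_distrib_left)
  finally show ?thesis .
qed

lemma dq_grid_affine:
  "dq_grid N (trunc_exp 1 0 (l * (b - a))) (L ` \<Gamma>) \<longleftrightarrow> dq_grid N (trunc_exp l a b) \<Gamma>"
proof (cases "finite \<Gamma> \<and> \<Gamma> \<noteq> {}")
  case True
  have mono: "mono L" using strict_mono_affine by (rule strict_mono_mono)
  have "Min (L ` \<Gamma>) = L (Min \<Gamma>)" "Max (L ` \<Gamma>) = L (Max \<Gamma>)"
    using mono_Min_commute[OF mono] mono_Max_commute[OF mono] True by simp_all
  moreover have "0 < l * (b - a)" using l ab by simp
  ultimately show ?thesis
    using l ab True by (simp add: dq_grid_trunc_exp card_affine) (simp add: L_def mult_le_0_iff)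
next
  case False
  moreover have "finite (L ` \<Gamma>) = finite \<Gamma>"
    using strict_mono_affine by (intro finite_image_iff strict_mono_imp_inj_on)
  ultimately show ?thesis
    using l ab by (simp add: dq_grid_trunc_exp) blast
qed

text \<open>The affine map is a bijection between the grids of the two measures and scales all
  errors by one positive factor, so minimizers correspond.\<close>

lemma dq_optimal_affine:
  "dq_optimal r N (trunc_exp l a b) \<Gamma> \<longleftrightarrow> dq_optimal r N (trunc_exp 1 0 (l * (b - a))) (L ` \<Gamma>)"
proof -
  have surj: "\<exists>\<Delta>. \<Delta>' = L ` \<Delta>" for \<Delta>'
    using l by (intro exI[of _ "(\<lambda>t. a + t / l) ` \<Delta>'"]) (simp add: image_image L_def)
  have fin: "finite \<Delta>" if "dq_grid N (trunc_exp l a b) \<Delta>" for \<Delta>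
    using that by (simp add: dq_grid_def)
  have err: "dq_error r (trunc_exp l a b) \<Gamma> \<le> dq_error r (trunc_exp l a b) \<Delta> \<longleftrightarrow>
      dq_error r (trunc_exp 1 0 (l * (b - a))) (L ` \<Gamma>) \<le> dq_error r (trunc_exp 1 0 (l * (b - a))) (L ` \<Delta>)"
    if "dq_grid N (trunc_exp l a b) \<Gamma>" "dq_grid N (trunc_exp l a b) \<Delta>" for \<Delta>
    using that l by (simp add: dq_error_affine fin)
  show ?thesis
    unfolding dq_optimal_def dq_grid_affine
  proof (intro conj_cong refl iffI allI impI)
    fix \<Delta>' assume *: "dq_grid N (trunc_exp l a b) \<Gamma>"
      "\<forall>\<Delta>. dq_grid N (trunc_exp l a b) \<Delta> \<longrightarrow> dq_error r (trunc_exp l a b) \<Gamma> \<le> dq_error r (trunc_exp l a b) \<Delta>"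
      "dq_grid N (trunc_exp 1 0 (l * (b - a))) \<Delta>'"
    obtain \<Delta> where "\<Delta>' = L ` \<Delta>" using surj by blast
    with * err dq_grid_affine show "dq_error r (trunc_exp 1 0 (l * (b - a))) (L ` \<Gamma>)
        \<le> dq_error r (trunc_exp 1 0 (l * (b - a))) \<Delta>'" by blast
  qed (use err dq_grid_affine in blast)
qed

end

subsection \<open>Optimal grids of truncated exponential distributions\<close>

lemma std_points:
  assumes r: "r \<ge> 1" and b: "b > 0" and N: "N \<ge> 2"
  shows "\<exists>x. x \<in> grid_seqs (N - 1) b \<and> stationary r (N - 1) x \<and>
    (\<forall>\<Gamma>. dq_optimal r N (trunc_exp 1 0 b) \<Gamma> \<longleftrightarrow> \<Gamma> = set (map x [0..<N])) \<and>
    sorted_wrt (<) (map x [0..<N]) \<and>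
    dq_points r N (trunc_exp 1 0 b) = map x [0..<N] \<and>
    (\<forall>i. 1 \<le> i \<longrightarrow> i \<le> N \<longrightarrow> std_point r N b i = x (i - 1))"
proof -
  have N': "Suc (N - 1) = N" "N - 1 > 0" using N by auto
  obtain x where x: "x \<in> grid_seqs (N - 1) b" "stationary r (N - 1) x"
    and opt: "\<And>\<Gamma>. dq_optimal r N (trunc_exp 1 0 b) \<Gamma> \<longleftrightarrow> \<Gamma> = set (map x [0..<N])"
    and sorted: "sorted_wrt (<) (map x [0..<N])"
    using dq_optimal_standard[OF r b N'(2)] unfolding N'(1) by blast
  have pts: "dq_points r N (trunc_exp 1 0 b) = map x [0..<N]"
    unfolding dq_points_def opt the_eq_trivial using sorted by (rule sorted_list_of_set_eqI)
  have "std_point r N b i = x (i - 1)" if "1 \<le> i" "i \<le> N" for i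
    using that by (simp add: std_point_def pts)
  with x opt sorted pts show ?thesis by (intro exI[of _ x] conjI allI impI) auto
qed

lemma dq_points_affine:
  assumes r: "r \<ge> 1" and N: "N \<ge> 2" and l: "l > 0" and ab: "a < b"
  shows "\<exists>!\<Gamma>. dq_optimal r N (trunc_exp l a b) \<Gamma>"
    and "dq_points r N (trunc_exp l a b) =
      map (\<lambda>i. a + 1 / l * std_point r N (l * (b - a)) i) [1..<Suc N]"
proof -
  define L where "L = (\<lambda>x. l * (x - a))"
  define L' where "L' = (\<lambda>t. a + 1 / l * t)"
  have LL': "L (L' t) = t" "L' (L t) = t" for t
    using l by (simp_all add: L_def L'_def)
  have "0 < l * (b - a)" using l ab by simp
  from std_points[OF r this N] obtain x where
    opt: "\<forall>\<Gamma>. dq_optimal r N (trunc_exp 1 0 (l * (b - a))) \<Gamma> \<longleftrightarrow> \<Gamma> = set (map x [0..<N])"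
    and sorted: "sorted_wrt (<) (map x [0..<N])"
    and pt: "\<forall>i. 1 \<le> i \<longrightarrow> i \<le> N \<longrightarrow> std_point r N (l * (b - a)) i = x (i - 1)"
    by (elim exE conjE)
  have "dq_optimal r N (trunc_exp l a b) \<Gamma> \<longleftrightarrow> L ` \<Gamma> = set (map x [0..<N])" for \<Gamma>
    using dq_optimal_affine[OF l ab] opt by (simp add: L_def)
  moreover have "L ` \<Gamma> = A \<longleftrightarrow> \<Gamma> = L' ` A" for \<Gamma> A
    by (auto simp: LL' image_image)
  ultimately have opt': "dq_optimal r N (trunc_exp l a b) \<Gamma> \<longleftrightarrow> \<Gamma> = set (map L' (map x [0..<N]))" for \<Gamma>
    by (simp only: set_map)
  then show "\<exists>!\<Gamma>. dq_optimal r N (trunc_exp l a b) \<Gamma>" by simp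
  have "sorted_wrt (<) (map L' (map x [0..<N]))"
    unfolding sorted_wrt_map[of _ L'] using sorted
    by (rule sorted_wrt_mono_rel[rotated]) (use l in \<open>simp add: L'_def divide_strict_right_mono\<close>)
  then have "dq_points r N (trunc_exp l a b) = map L' (map x [0..<N])"
    unfolding dq_points_def opt' the_eq_trivial by (rule sorted_list_of_set_eqI)
  \<comment> \<open>The indices pass from numbering from 0 to the numbering from 1 of
    \<open>std_point\<close>.\<close>
  also have "\<dots> = map (\<lambda>i. a + 1 / l * std_point r N (l * (b - a)) i) [1..<Suc N]"
    by (rule nth_equalityI) (auto simp: L'_def pt simp del: upt_Suc)
  finally show "dq_points r N (trunc_exp l a b) =
      map (\<lambda>i. a + 1 / l * std_point r N (l * (b - a)) i) [1..<Suc N]" .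
qed

subsection \<open>The gaps of the optimal grid\<close>

text \<open>Forward counterpart of \<open>stationary_gap\<close>. It uses \<open>T\<close> only
  along the given gaps and so suits \<open>theta1\<close>, which is meaningful only on
  \<open>theta1_dom\<close>.\<close>

lemma funpow_orbit:
  assumes "\<And>i. Suc i < n \<Longrightarrow> T (d i) = d (Suc i)" "i < n"
  shows "(T ^^ i) (d 0) = d i"
  using assms(2) by (induction i) (auto simp: assms(1))

lemma increasing_bij_inv_into:
  assumes "increasing_bij f A B" "x \<in> A" "f x = y"
  shows "inv_into A f y = x"
  using assms by (auto simp: increasing_bij_def bij_betw_def intro: inv_into_f_f)

lemma strict_mono_on_theta2: "strict_mono_on {0..} theta2"
  unfolding theta2_def[abs_def]
  by (intro strict_mono_on_inv_into_comp increasing_bij_Phi_2 strict_mono_on_Phi_check) auto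

lemma theta2_nonneg: "x \<ge> 0 \<Longrightarrow> theta2 x \<ge> 0"
  unfolding theta2_def
  by (intro strict_mono_on_inv_into_comp increasing_bij_Phi_2 strict_mono_on_Phi_check) auto

lemma theta2_eqI: "y \<ge> 0 \<Longrightarrow> Phi_check 2 x = Phi 2 y \<Longrightarrow> theta2 x = y"
  unfolding theta2_def by (rule increasing_bij_inv_into[OF increasing_bij_Phi_2]) auto

lemma theta1_eqI: "x > 0 \<Longrightarrow> y > 0 \<Longrightarrow> Phi_check 1 x = Phi 1 y \<Longrightarrow> theta1 x = y"
  unfolding theta1_def using increasing_bij_inv_into[OF increasing_bij_Phi_1, of y] by simp

text \<open>The right end of \<open>theta1_dom\<close> is where \<open>Phi_check 1\<close> reaches
  2, the supremum of \<open>Phi 1\<close>; monotonicity places \<open>x\<close> to its left.\<close>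

lemma theta1_domI:
  assumes "x > 0" "Phi_check 1 x < 2"
  shows "x \<in> theta1_dom"
proof -
  define z where "z = inv_into {0<..} (Phi_check 1) 2"
  have "(2::real) \<in> Phi_check 1 ` {0<..}"
    using increasing_bij_Phi_check_Ioi[of 1] by (auto simp: increasing_bij_def bij_betw_def)
  from inv_into_into[OF this] f_inv_into_f[OF this] have z: "z > 0" "Phi_check 1 z = 2"
    by (simp_all add: z_def)
  then have "x < z"
    using assms strict_mono_on_leD[OF strict_mono_on_Phi_check[of 1], of z x] by (cases "x < z") auto
  then show ?thesis using assms by (simp add: theta1_dom_def z_def)
qed

theorem mainTheorem6:
  fixes r l a b b' :: real and N :: nat
  assumes "r \<ge> 1" and "N \<ge> 3" and "l > 0" and "a < b" and "b' > 0"
  shows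
    "(\<exists>!\<Gamma>. dq_optimal r N (trunc_exp 1 0 b') \<Gamma>) \<and>
     length (dq_points r N (trunc_exp 1 0 b')) = N \<and>
     std_point r N b' 1 = 0 \<and> std_point r N b' N = b' \<and>
     \<comment> \<open>(i)\<close>
     ((\<exists>!\<Gamma>. dq_optimal r N (trunc_exp l a b) \<Gamma>) \<and>
      dq_points r N (trunc_exp l a b) =
        map (\<lambda>i. a + 1 / l * std_point r N (l * (b - a)) i) [1..<Suc N]) \<and>
     \<comment> \<open>(ii)\<close>
     (r = 2 \<longrightarrow>
        increasing_bij (Phi 2) {0..} {0..} \<and>
        increasing_bij (Phi_check 2) {0..} {0..} \<and>
        (\<exists>!x. x \<ge> 0 \<and> (\<Sum>k=0..N-2. (theta2 ^^ k) x) = b') \<and>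
        (\<forall>x\<ge>0. (\<Sum>k=0..N-2. (theta2 ^^ k) x) = b' \<longrightarrow>
           (\<forall>i\<in>{2..N}. std_gap r N b' i = (theta2 ^^ (i - 2)) x))) \<and>
     \<comment> \<open>(iii)\<close>
     (r > 1 \<longrightarrow>
        increasing_bij (Phi_check r) {0..} {0..} \<and>
        (\<exists>!x. x \<ge> 0 \<and> (\<Sum>k=0..N-2. (theta_tilde r ^^ k) x) = b') \<and>
        (\<forall>x\<ge>0. (\<Sum>k=0..N-2. (theta_tilde r ^^ k) x) = b' \<longrightarrow>
           (\<forall>i\<in>{2..N}. std_gap r N b' i = (theta_tilde r ^^ (N - i)) x))) \<and>
     \<comment> \<open>(iv)\<close>
     (r = 1 \<longrightarrow>
        increasing_bij (Phi 1) {0<..} {0<..<2} \<and>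
        increasing_bij (Phi_check 1) {0<..} {0<..} \<and>
        (\<exists>x\<ge>0. (\<forall>k<N-2. (theta1 ^^ k) x \<in> theta1_dom) \<and>
           (\<Sum>k=0..N-2. (theta1 ^^ k) x) = b' \<and>
           (\<forall>i\<in>{2..N}. std_gap r N b' i = (theta1 ^^ (i - 2)) x)))"
proof -
  note r = assms(1) and N = assms(2) and b' = assms(5)
  define n where "n = N - 1"
  have N2: "N \<ge> 2" using N by simp
  have ivl: "{0..N-2} = {..<n}" using N by (auto simp: n_def)
  from std_points[OF r b' N2, folded n_def] obtain x where
    x: "x \<in> grid_seqs n b'" and st: "stationary r n x"
    and opt: "\<forall>\<Gamma>. dq_optimal r N (trunc_exp 1 0 b') \<Gamma> \<longleftrightarrow> \<Gamma> = set (map x [0..<N])"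
    and pts: "dq_points r N (trunc_exp 1 0 b') = map x [0..<N]"
    and pt: "\<forall>i. 1 \<le> i \<longrightarrow> i \<le> N \<longrightarrow> std_point r N b' i = x (i - 1)"
    by (elim exE conjE)
  \<comment> \<open>\<open>d i\<close> is the gap with number \<open>i + 2\<close> in the numbering
    of the statement; there are \<open>n = N - 1\<close> gaps.\<close>
  define d where "d i = x (Suc i) - x i" for i
  have d_pos: "d i > 0" if "i < n" for i
    using stationary_gap_pos[OF r b' x st that] by (simp add: d_def)
  have d_sum: "(\<Sum>i<n. d i) = b'"
    unfolding d_def by (rule grid_seqs_sum_gaps[OF x])
  have d_st: "Phi_check r (d i) = Phi r (d (Suc i))" if "Suc i < n" for i
    using st that by (simp add: stationary_def d_def)
  have gap: "std_gap r N b' i = d (i - 2)" if "i \<in> {2..N}" for i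
  proof -
    have points: "std_point r N b' i = x (i - 1)" "std_point r N b' (i - 1) = x (i - 2)"
      using pt[rule_format, of i] pt[rule_format, of "i - 1"] that by (auto simp: numeral_2_eq_2)
    have "Suc (i - 2) = i - 1" using that by auto
    then show ?thesis unfolding std_gap_def d_def points by simp
  qed
  have gap_index: "i - 2 < n" if "i \<in> {2..N}" for i
    using that N by (auto simp: n_def)
  have unique: "y = z" if "strict_mono_on {0..} T" "\<And>x. x \<ge> 0 \<Longrightarrow> T x \<ge> 0" "y \<ge> 0" "z \<ge> 0"
      "(\<Sum>k<n. (T ^^ k) y) = b'" "(\<Sum>k<n. (T ^^ k) z) = b'" for T :: "real \<Rightarrow> real" and y z
    using that N by (intro iterate_sum_inj[of T n y z]) (auto simp: n_def)
  have part_ii: "increasing_bij (Phi 2) {0..} {0..} \<and> increasing_bij (Phi_check 2) {0..} {0..} \<and>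
        (\<exists>!x. x \<ge> 0 \<and> (\<Sum>k<n. (theta2 ^^ k) x) = b') \<and>
        (\<forall>x\<ge>0. (\<Sum>k<n. (theta2 ^^ k) x) = b' \<longrightarrow>
           (\<forall>i\<in>{2..N}. std_gap r N b' i = (theta2 ^^ (i - 2)) x))" if r2: "r = 2"
  proof -
    \<comment> \<open>The stationarity relation read forwards: each gap determines the next one
      through the inverse of \<open>Phi 2\<close>.\<close>
    have orbit: "(theta2 ^^ i) (d 0) = d i" if "i < n" for i
      using d_st d_pos r2 that by (intro funpow_orbit[of n theta2] theta2_eqI) (auto simp: less_imp_le)
    have d0: "d 0 \<ge> 0" "(\<Sum>k<n. (theta2 ^^ k) (d 0)) = b'"
      using d_pos[of 0] N orbit d_sum by (auto simp: n_def)
    have uniq: "z = d 0" if "z \<ge> 0" "(\<Sum>k<n. (theta2 ^^ k) z) = b'" for z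
      by (rule unique[OF strict_mono_on_theta2]) (fact theta2_nonneg that d0)+
    have gap2: "std_gap r N b' i = (theta2 ^^ (i - 2)) (d 0)" if "i \<in> {2..N}" for i
      using gap[OF that] orbit[of "i - 2"] gap_index[OF that] by simp
    show ?thesis
    proof (intro conjI allI impI ballI)
      show "\<exists>!x. x \<ge> 0 \<and> (\<Sum>k<n. (theta2 ^^ k) x) = b'"
      proof (rule ex1I)
        show "d 0 \<ge> 0 \<and> (\<Sum>k<n. (theta2 ^^ k) (d 0)) = b'" using d0 by blast
        show "z = d 0" if "z \<ge> 0 \<and> (\<Sum>k<n. (theta2 ^^ k) z) = b'" for z
          by (rule uniq) (use that in auto)
      qed
      show "std_gap r N b' i = (theta2 ^^ (i - 2)) z"
        if "z \<ge> 0" "(\<Sum>k<n. (theta2 ^^ k) z) = b'" "i \<in> {2..N}" for z i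
        unfolding uniq[OF that(1,2)] using that(3) by (rule gap2)
    qed (use increasing_bij_Phi_2 increasing_bij_Phi_check[of 2] in simp_all)
  qed
  have part_iii: "increasing_bij (Phi_check r) {0..} {0..} \<and>
        (\<exists>!x. x \<ge> 0 \<and> (\<Sum>k<n. (theta_tilde r ^^ k) x) = b') \<and>
        (\<forall>x\<ge>0. (\<Sum>k<n. (theta_tilde r ^^ k) x) = b' \<longrightarrow>
           (\<forall>i\<in>{2..N}. std_gap r N b' i = (theta_tilde r ^^ (N - i)) x))"
  proof -
    define y where "y = x n - x (n - 1)"
    have y: "y \<ge> 0" "(\<Sum>k<n. (theta_tilde r ^^ k) y) = b'"
      using grid_seqs_mono[OF x, of "n - 1" n] stationary_sum[OF r x st] by (simp_all add: y_def)
    have uniq: "z = y" if "z \<ge> 0" "(\<Sum>k<n. (theta_tilde r ^^ k) z) = b'" for z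
      by (rule unique[OF strict_mono_on_theta_tilde[OF r]]) (fact theta_tilde_nonneg[OF r] that y)+
    \<comment> \<open>Gap \<open>N\<close> is the last one, so gap \<open>i\<close> lies
      \<open>N - i\<close> backward steps from it.\<close>
    have gap3: "std_gap r N b' i = (theta_tilde r ^^ (N - i)) y" if i: "i \<in> {2..N}" for i
    proof -
      have "n - (N - i) = Suc (i - 2)" "n - Suc (N - i) = i - 2" "N - i < n"
        using i N by (auto simp: n_def)
      with stationary_gap[OF r x st, of "N - i"] show ?thesis
        using i by (simp add: gap d_def y_def)
    qed
    show ?thesis
    proof (intro conjI allI impI ballI)
      show "\<exists>!x. x \<ge> 0 \<and> (\<Sum>k<n. (theta_tilde r ^^ k) x) = b'"
      proof (rule ex1I)
        show "y \<ge> 0 \<and> (\<Sum>k<n. (theta_tilde r ^^ k) y) = b'" using y by blast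
        show "z = y" if "z \<ge> 0 \<and> (\<Sum>k<n. (theta_tilde r ^^ k) z) = b'" for z
          by (rule uniq) (use that in auto)
      qed
      show "std_gap r N b' i = (theta_tilde r ^^ (N - i)) z"
        if "z \<ge> 0" "(\<Sum>k<n. (theta_tilde r ^^ k) z) = b'" "i \<in> {2..N}" for z i
        unfolding uniq[OF that(1,2)] using that(3) by (rule gap3)
    qed (rule increasing_bij_Phi_check[OF r])
  qed
  have part_iv: "increasing_bij (Phi 1) {0<..} {0<..<2} \<and> increasing_bij (Phi_check 1) {0<..} {0<..} \<and>
        (\<exists>x\<ge>0. (\<forall>k<N-2. (theta1 ^^ k) x \<in> theta1_dom) \<and> (\<Sum>k<n. (theta1 ^^ k) x) = b' \<and>
           (\<forall>i\<in>{2..N}. std_gap r N b' i = (theta1 ^^ (i - 2)) x))" if r1: "r = 1"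
  proof -
    have orbit: "(theta1 ^^ i) (d 0) = d i" if "i < n" for i
      using d_st d_pos r1 that by (intro funpow_orbit[of n theta1] theta1_eqI) auto
    \<comment> \<open>A gap with a successor satisfies
      \<open>Phi_check 1 (d k) = Phi 1 (d (Suc k)) < 2\<close>. Between the \<open>N - 1\<close>
      gaps there are \<open>N - 2\<close> steps, whence the range of \<open>k\<close>.\<close>
    have dom: "(theta1 ^^ k) (d 0) \<in> theta1_dom" if "k < N - 2" for k
    proof -
      have k: "Suc k < n" using that by (simp add: n_def)
      have "Phi 1 (d (Suc k)) < 2"
        using increasing_bij_Phi_1 d_pos[OF k] by (auto simp: increasing_bij_def bij_betw_def)
      then show ?thesis
        using d_st[OF k] d_pos[of k] k r1 orbit[of k] by (auto intro: theta1_domI)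
    qed
    have gap4: "std_gap r N b' i = (theta1 ^^ (i - 2)) (d 0)" if "i \<in> {2..N}" for i
      using gap[OF that] orbit[of "i - 2"] gap_index[OF that] by simp
    have d0: "d 0 \<ge> 0" "(\<Sum>k<n. (theta1 ^^ k) (d 0)) = b'"
      using d_pos[of 0] N orbit d_sum by (auto simp: n_def)
    show ?thesis
      by (intro conjI exI[of _ "d 0"] allI impI ballI d0 dom gap4)
        (use increasing_bij_Phi_1 increasing_bij_Phi_check_Ioi[of 1] in simp_all)
  qed
  have ex1: "\<exists>!\<Gamma>. dq_optimal r N (trunc_exp 1 0 b') \<Gamma>" using opt by simp
  have len: "length (dq_points r N (trunc_exp 1 0 b')) = N" by (simp add: pts)
  have ends: "std_point r N b' 1 = 0" "std_point r N b' N = b'"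
    using x N by (auto simp: pt grid_seqs_def n_def)
  show ?thesis
    unfolding ivl
    by (intro conjI[OF ex1] conjI[OF len] conjI[OF ends(1)] conjI[OF ends(2)]
        conjI[OF conjI[OF dq_points_affine[OF r N2 assms(3,4)]]])
      (rule conjI, rule impI, erule part_ii, rule conjI, rule impI, rule part_iii, rule impI, erule part_iv)
qed

end
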